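(* Suppose that for every $\beta\in\Phi^+$ one has $\mathrm{Newton}(F_\beta)=\mathrm{conv}\{w(I,k)-w(I_{ag},k): I\text{ facet of }\mathcal{S}(Q)\}$, where $k\in\{n+1,\dots,n+N\}$ is the unique index with $r(I_g,k)=\beta$. Then: (1) the brick polytope $\mathcal{B}(Q)$ coincides up to translation with the Minkowski sum $\sum_{\beta\in\Phi^+}\mathrm{Newton}(F_\beta)\subset V$; (2) for a suitable affine embedding $\varphi:V\to V\oplus V$, the Minkowski sum $\sum_{\beta\in\Phi^+}\mathrm{Newton}(u_\beta)$ lies in $\varphi(V)$, and it coincides, up to translation, with the image of $\mathcal{B}(Q)$ under $\varphi$.
   Context: Let $(W,\mathcal{S})$ be a finite crystallographic Coxeter system of rank $n$ acting on a Euclidean space $V$. It has simple roots $\Delta$, fundamental weights $\omega_s$, Cartan matrix $a_{st}$, positive roots $\Phi^+$ with $N=|\Phi^+|$, and longest element $w_\circ$. Fix a Coxeter element $c$ with reduced word $s_1\cdots s_n$, and write $\alpha_i=\alpha_{s_i}$. Let $\mathbf{w}_\circ(c)=q_1\cdots q_N$ be the lexicographically first subword of $s_1\cdots s_ns_1\cdots s_n\cdots$ that is a reduced word for $w_\circ$. Let $Q=Q_1\cdots Q_{n+N}=s_1\cdots s_nq_1\cdots q_N$. Facets of $\mathcal{S}(Q)$ are the $n$-subsets $I\subseteq[n+N]$ whose deletion from $Q$ leaves a reduced word for $w_\circ$. $I_g$ and $I_{ag}$ are the lexicographically first and last facets. With $\Pi_{I,k}$ the ordered product of the $Q_x$ for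 $x\in[k-1]\setminus I$, the root function is $r(I,k)=\Pi_{I,k}(\alpha_{Q_k})$ and the weight function is $w(I,k)=\Pi_{I,k}(\omega_{Q_k})$. The brick vector of a facet $I$ is $\mathbf{b}(I)=\sum_{k=1}^{n+N}w(I,k)$. The brick polytope is $\mathcal{B}(Q)=\mathrm{conv}\{\mathbf{b}(I): I\text{ facet}\}$. $\mathcal{A}(W,c)$ is the cluster algebra with principal coefficients with initial extended exchange matrix $\begin{bmatrix}B_c\\ \mathrm{Id}_n\end{bmatrix}$, where $B_c=(b_{ij})$ has $b_{ij}=-a_{s_is_j}$ if $i<j$, $b_{ij}=a_{s_is_j}$ if $i>j$, $b_{ii}=0$. Its initial cluster is $\mathbf{x}$ and its coefficients are $\mathbf{y}$. A cluster variable $u=p(\mathbf{x},\mathbf{y})/x^d$ has $d$-vector $\sum d_i\alpha_i$; non-initial cluster variables $u_\beta$ correspond to $\beta\in\Phi^+$ via $d$-vectors. $F_\beta(\mathbf{y})=u_\beta(1,\dots,1,\mathbf{y})$. $\mathrm{Newton}(F_\beta)$ is the convex hull of the exponent vectors $\sum\lambda_i\alpha_i$ of the monomials of $F_\beta$. $\mathrm{Newton}(u_\beta)$ is the convex hull of the exponent vectors of the Laurent monomials $\mathbf{x}^a\mathbf{y}^\lambda$ of $u_\beta$, viewed in $V\oplus V$ via $(a,\lambda)\mapsto(\sum a_i\alpha_i,\sum\lambda_i\alpha_i)$. *)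

theory Defs
  imports
    "HOL-Analysis.Analysis"
    "HOL-Library.Poly_Mapping"
    "HOL-Computational_Algebra.Fraction_Field"
begin

section \<open>Finite crystallographic reflection groups\<close>

definition reflection :: "'a::euclidean_space \<Rightarrow> 'a \<Rightarrow> 'a" where
  "reflection a v = v - (2 * (a \<bullet> v) / (a \<bullet> a)) *\<^sub>R a"

definition crystallographic_root_system :: "'a::euclidean_space set \<Rightarrow> bool" where
  "crystallographic_root_system \<Phi> \<longleftrightarrow>
     finite \<Phi> \<and> 0 \<notin> \<Phi> \<and> span \<Phi> = UNIV \<and>
     (\<forall>a\<in>\<Phi>. reflection a ` \<Phi> = \<Phi>) \<and>
     (\<forall>a\<in>\<Phi>. \<Phi> \<inter> span {a} = {a, - a}) \<and>
     (\<forall>a\<in>\<Phi>. \<forall>b\<in>\<Phi>. 2 * (a \<bullet> b) / (a \<bullet> a) \<in> \<int>)"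

definition nonneg_combination :: "'a::real_vector set \<Rightarrow> 'a \<Rightarrow> bool" where
  "nonneg_combination \<Delta> v \<longleftrightarrow> (\<exists>f. (\<forall>a\<in>\<Delta>. 0 \<le> f a) \<and> v = (\<Sum>a\<in>\<Delta>. f a *\<^sub>R a))"

definition simple_system :: "'a::euclidean_space set \<Rightarrow> 'a set \<Rightarrow> bool" where
  "simple_system \<Phi> \<Delta> \<longleftrightarrow>
     \<Delta> \<subseteq> \<Phi> \<and> independent \<Delta> \<and>
     (\<forall>b\<in>\<Phi>. nonneg_combination \<Delta> b \<or> nonneg_combination \<Delta> (- b))"

definition positive_roots :: "'a::euclidean_space set \<Rightarrow> 'a set \<Rightarrow> 'a set" where
  "positive_roots \<Phi> \<Delta> = {b \<in> \<Phi>. nonneg_combination \<Delta> b}"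

text \<open>
  Below, \<open>\<alpha> 1, \<dots>, \<alpha> n\<close> is an enumeration of the simple roots, and the number \<open>i\<close> stands for the
  simple reflection in \<open>\<alpha> i\<close>. The Coxeter element is \<open>c = s\<^sub>1 \<cdots> s\<^sub>n\<close>; every reduced word of every
  Coxeter element arises from some enumeration.
  The Cartan matrix is normalised by \<open>s\<^sub>i (\<alpha> j) = \<alpha> j - a\<^sub>i\<^sub>j \<alpha> i\<close> and the fundamental weights by
  \<open>s\<^sub>j (\<omega> i) = \<omega> i - \<delta>\<^sub>i\<^sub>j \<alpha> i\<close>.
\<close>

text \<open>The rounding is vacuous for a crystallographic root system.\<close>
definition cartan :: "(nat \<Rightarrow> 'a::euclidean_space) \<Rightarrow> nat \<Rightarrow> nat \<Rightarrow> int" where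
  "cartan \<alpha> i j = \<lfloor>2 * (\<alpha> i \<bullet> \<alpha> j) / (\<alpha> i \<bullet> \<alpha> i)\<rfloor>"

definition fundamental_weight :: "(nat \<Rightarrow> 'a::euclidean_space) \<Rightarrow> nat \<Rightarrow> nat \<Rightarrow> 'a" where
  "fundamental_weight \<alpha> n i =
     (THE w. \<forall>j\<in>{1..n}. 2 * (\<alpha> j \<bullet> w) / (\<alpha> j \<bullet> \<alpha> j) = (if i = j then 1 else 0))"

text \<open>\<open>word_act \<alpha> [i\<^sub>1, \<dots>, i\<^sub>l]\<close> is the group element \<open>s\<^bsub>i\<^sub>1\<^esub> \<circ> \<cdots> \<circ> s\<^bsub>i\<^sub>l\<^esub>\<close>.\<close>
definition word_act :: "(nat \<Rightarrow> 'a::euclidean_space) \<Rightarrow> nat list \<Rightarrow> 'a \<Rightarrow> 'a" where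
  "word_act \<alpha> w = foldr (\<lambda>i. reflection (\<alpha> i)) w"

definition coxeter_group :: "(nat \<Rightarrow> 'a::euclidean_space) \<Rightarrow> nat \<Rightarrow> ('a \<Rightarrow> 'a) set" where
  "coxeter_group \<alpha> n = {word_act \<alpha> w | w. set w \<subseteq> {1..n}}"

definition coxeter_length :: "(nat \<Rightarrow> 'a::euclidean_space) \<Rightarrow> nat \<Rightarrow> ('a \<Rightarrow> 'a) \<Rightarrow> nat" where
  "coxeter_length \<alpha> n g = (LEAST l. \<exists>w. set w \<subseteq> {1..n} \<and> length w = l \<and> word_act \<alpha> w = g)"

definition reduced_word :: "(nat \<Rightarrow> 'a::euclidean_space) \<Rightarrow> nat \<Rightarrow> ('a \<Rightarrow> 'a) \<Rightarrow> nat list \<Rightarrow> bool" where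
  "reduced_word \<alpha> n g w \<longleftrightarrow>
     set w \<subseteq> {1..n} \<and> word_act \<alpha> w = g \<and> length w = coxeter_length \<alpha> n g"

definition longest_element :: "(nat \<Rightarrow> 'a::euclidean_space) \<Rightarrow> nat \<Rightarrow> 'a \<Rightarrow> 'a" where
  "longest_element \<alpha> n =
     (THE g. g \<in> coxeter_group \<alpha> n \<and>
             (\<forall>h\<in>coxeter_group \<alpha> n. coxeter_length \<alpha> n h \<le> coxeter_length \<alpha> n g))"


section \<open>The subword complex and its brick polytope\<close>

text \<open>Finite sets of positions are compared lexicographically as increasing lists.\<close>
definition lex_less :: "nat set \<Rightarrow> nat set \<Rightarrow> bool" where
  "lex_less I J \<longleftrightarrow> (sorted_list_of_set I, sorted_list_of_set J) \<in> lexord {(x, y). x < y}"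

definition lex_first :: "nat set set \<Rightarrow> nat set" where
  "lex_first \<I> = (THE I. I \<in> \<I> \<and> (\<forall>J\<in>\<I>. J \<noteq> I \<longrightarrow> lex_less I J))"

definition lex_last :: "nat set set \<Rightarrow> nat set" where
  "lex_last \<I> = (THE I. I \<in> \<I> \<and> (\<forall>J\<in>\<I>. J \<noteq> I \<longrightarrow> lex_less J I))"

definition subword :: "(nat \<Rightarrow> nat) \<Rightarrow> nat set \<Rightarrow> nat list" where
  "subword q X = map q (sorted_list_of_set X)"

text \<open>The letters of \<open>s\<^sub>1 \<cdots> s\<^sub>n s\<^sub>1 \<cdots> s\<^sub>n \<cdots>\<close>, at positions \<open>0, 1, 2, \<dots>\<close>.\<close>
definition periodic_letter :: "nat \<Rightarrow> nat \<Rightarrow> nat" where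
  "periodic_letter n p = p mod n + 1"

definition sorting_word :: "(nat \<Rightarrow> 'a::euclidean_space) \<Rightarrow> nat \<Rightarrow> nat list" where
  "sorting_word \<alpha> n =
     subword (periodic_letter n)
       (lex_first {P. finite P \<and>
          reduced_word \<alpha> n (longest_element \<alpha> n) (subword (periodic_letter n) P)})"

text \<open>
  \<open>Q = Q\<^sub>1 \<cdots> Q\<^bsub>n+N\<^esub>\<close>. Positions start at 1, so that \<open>[n + N]\<close> is \<open>{1..length (Q_word \<alpha> n)}\<close>.
\<close>
definition Q_word :: "(nat \<Rightarrow> 'a::euclidean_space) \<Rightarrow> nat \<Rightarrow> nat list" where
  "Q_word \<alpha> n = [1..<Suc n] @ sorting_word \<alpha> n"

definition Q_letter :: "(nat \<Rightarrow> 'a::euclidean_space) \<Rightarrow> nat \<Rightarrow> nat \<Rightarrow> nat" where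
  "Q_letter \<alpha> n k = Q_word \<alpha> n ! (k - 1)"

definition facets :: "(nat \<Rightarrow> 'a::euclidean_space) \<Rightarrow> nat \<Rightarrow> nat set set" where
  "facets \<alpha> n =
     {I. I \<subseteq> {1..length (Q_word \<alpha> n)} \<and> card I = n \<and>
         reduced_word \<alpha> n (longest_element \<alpha> n)
           (subword (Q_letter \<alpha> n) ({1..length (Q_word \<alpha> n)} - I))}"

definition greedy_facet :: "(nat \<Rightarrow> 'a::euclidean_space) \<Rightarrow> nat \<Rightarrow> nat set" where
  "greedy_facet \<alpha> n = lex_first (facets \<alpha> n)"

definition antigreedy_facet :: "(nat \<Rightarrow> 'a::euclidean_space) \<Rightarrow> nat \<Rightarrow> nat set" where
  "antigreedy_facet \<alpha> n = lex_last (facets \<alpha> n)"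

definition prefix_product :: "(nat \<Rightarrow> 'a::euclidean_space) \<Rightarrow> nat \<Rightarrow> nat set \<Rightarrow> nat \<Rightarrow> 'a \<Rightarrow> 'a" where
  "prefix_product \<alpha> n I k = word_act \<alpha> (subword (Q_letter \<alpha> n) ({1..<k} - I))"

definition root_function :: "(nat \<Rightarrow> 'a::euclidean_space) \<Rightarrow> nat \<Rightarrow> nat set \<Rightarrow> nat \<Rightarrow> 'a" where
  "root_function \<alpha> n I k = prefix_product \<alpha> n I k (\<alpha> (Q_letter \<alpha> n k))"

definition weight_function :: "(nat \<Rightarrow> 'a::euclidean_space) \<Rightarrow> nat \<Rightarrow> nat set \<Rightarrow> nat \<Rightarrow> 'a" where
  "weight_function \<alpha> n I k =
     prefix_product \<alpha> n I k (fundamental_weight \<alpha> n (Q_letter \<alpha> n k))"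

definition brick_vector :: "(nat \<Rightarrow> 'a::euclidean_space) \<Rightarrow> nat \<Rightarrow> nat set \<Rightarrow> 'a" where
  "brick_vector \<alpha> n I = (\<Sum>k = 1..length (Q_word \<alpha> n). weight_function \<alpha> n I k)"

definition brick_polytope :: "(nat \<Rightarrow> 'a::euclidean_space) \<Rightarrow> nat \<Rightarrow> 'a set" where
  "brick_polytope \<alpha> n = convex hull (brick_vector \<alpha> n ` facets \<alpha> n)"

definition root_position :: "(nat \<Rightarrow> 'a::euclidean_space) \<Rightarrow> nat \<Rightarrow> 'a \<Rightarrow> nat" where
  "root_position \<alpha> n b =
     (THE k. k \<in> {n + 1..length (Q_word \<alpha> n)} \<and> root_function \<alpha> n (greedy_facet \<alpha> n) k = b)"


section \<open>The cluster algebra with principal coefficients\<close>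

text \<open>
  Laurent polynomials with integer coefficients: exponent vectors are finitely supported
  maps from variable indices to integers. Variable \<open>i \<in> {1..n}\<close> is \<open>x\<^sub>i\<close> and variable \<open>n + i\<close>
  is \<open>y\<^sub>i\<close>; no other variables ever occur. The ambient field of rational functions is the
  fraction field of the Laurent polynomial ring.
\<close>
type_synonym laurent = "(nat \<Rightarrow>\<^sub>0 int) \<Rightarrow>\<^sub>0 int"

definition laurent_var :: "nat \<Rightarrow> laurent" where
  "laurent_var i = Poly_Mapping.single (Poly_Mapping.single i 1) 1"

definition rat_fun :: "laurent \<Rightarrow> laurent fract" where
  "rat_fun L = Fract L 1"

text \<open>Rows \<open>1, \<dots>, n\<close> hold \<open>B\<^sub>c\<close>, rows \<open>n + 1, \<dots>, 2n\<close> the identity.\<close>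
definition initial_matrix :: "(nat \<Rightarrow> 'a::euclidean_space) \<Rightarrow> nat \<Rightarrow> nat \<Rightarrow> nat \<Rightarrow> int" where
  "initial_matrix \<alpha> n i j =
     (if i \<in> {1..n} \<and> j \<in> {1..n} then
        (if i < j then - cartan \<alpha> i j else if i > j then cartan \<alpha> i j else 0)
      else if j \<in> {1..n} \<and> i = n + j then 1 else 0)"

definition mutate_matrix :: "nat \<Rightarrow> (nat \<Rightarrow> nat \<Rightarrow> int) \<Rightarrow> nat \<Rightarrow> nat \<Rightarrow> int" where
  "mutate_matrix k B i j =
     (if i = k \<or> j = k then - B i j
      else B i j + sgn (B i k) * max 0 (B i k * B k j))"

definition mutate_cluster ::
    "nat \<Rightarrow> nat \<Rightarrow> (nat \<Rightarrow> nat \<Rightarrow> int) \<Rightarrow> (nat \<Rightarrow> laurent fract) \<Rightarrow> nat \<Rightarrow> laurent fract" where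
  "mutate_cluster n k B z =
     z(k := ((\<Prod>i = 1..2 * n. z i ^ nat (B i k)) + (\<Prod>i = 1..2 * n. z i ^ nat (- B i k))) / z k)"

text \<open>A seed consists of its extended exchange matrix and its extended cluster, the entries
  \<open>n + 1, \<dots>, 2n\<close> of which are the frozen variables \<open>y\<close>.\<close>
inductive seed ::
    "(nat \<Rightarrow> 'a::euclidean_space) \<Rightarrow> nat \<Rightarrow> (nat \<Rightarrow> nat \<Rightarrow> int) \<Rightarrow> (nat \<Rightarrow> laurent fract) \<Rightarrow> bool"
  for \<alpha> n where
  initial: "seed \<alpha> n (initial_matrix \<alpha> n) (\<lambda>i. rat_fun (laurent_var i))"
| mutate: "seed \<alpha> n B z \<Longrightarrow> k \<in> {1..n} \<Longrightarrow>
    seed \<alpha> n (mutate_matrix k B) (mutate_cluster n k B z)"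

definition cluster_variables :: "(nat \<Rightarrow> 'a::euclidean_space) \<Rightarrow> nat \<Rightarrow> laurent fract set" where
  "cluster_variables \<alpha> n = {z i | z i. (\<exists>B. seed \<alpha> n B z) \<and> i \<in> {1..n}}"

definition non_initial_cluster_variables ::
    "(nat \<Rightarrow> 'a::euclidean_space) \<Rightarrow> nat \<Rightarrow> laurent fract set" where
  "non_initial_cluster_variables \<alpha> n =
     cluster_variables \<alpha> n - (\<lambda>i. rat_fun (laurent_var i)) ` {1..n}"

definition is_polynomial :: "laurent \<Rightarrow> bool" where
  "is_polynomial p \<longleftrightarrow> (\<forall>e\<in>Poly_Mapping.keys p. \<forall>i. 0 \<le> Poly_Mapping.lookup e i)"

text \<open>\<open>u = p(x, y) / x\<^sup>d\<close> for a polynomial \<open>p\<close> divisible by none of \<open>x\<^sub>1, \<dots>, x\<^sub>n\<close>;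
  divisibility is in the polynomial ring, since \<open>x\<^sub>i\<close> is a unit among Laurent polynomials.\<close>
definition has_d_vector ::
    "(nat \<Rightarrow> 'a::euclidean_space) \<Rightarrow> nat \<Rightarrow> laurent fract \<Rightarrow> 'a \<Rightarrow> bool" where
  "has_d_vector \<alpha> n u v \<longleftrightarrow>
     (\<exists>p d. is_polynomial p \<and>
        (\<forall>i\<in>{1..n}. \<not> (\<exists>q. is_polynomial q \<and> p = laurent_var i * q)) \<and>
        u = rat_fun p / (\<Prod>i = 1..n. rat_fun (laurent_var i) powi d i) \<and>
        v = (\<Sum>i = 1..n. of_int (d i) *\<^sub>R \<alpha> i))"

definition laurent_expansion :: "laurent fract \<Rightarrow> laurent" where
  "laurent_expansion u = (THE L. u = rat_fun L)"

text \<open>The substitution \<open>x\<^sub>1 = \<cdots> = x\<^sub>n = 1\<close>.\<close>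
definition set_x_one :: "nat \<Rightarrow> laurent \<Rightarrow> laurent" where
  "set_x_one n L =
     (\<Sum>e\<in>Poly_Mapping.keys L.
        Poly_Mapping.single
          (\<Sum>i = 1..n. Poly_Mapping.single (n + i) (Poly_Mapping.lookup e (n + i)))
          (Poly_Mapping.lookup L e))"

definition F_polynomial :: "nat \<Rightarrow> laurent fract \<Rightarrow> laurent" where
  "F_polynomial n u = set_x_one n (laurent_expansion u)"

definition x_exponent :: "(nat \<Rightarrow> 'a::euclidean_space) \<Rightarrow> nat \<Rightarrow> (nat \<Rightarrow>\<^sub>0 int) \<Rightarrow> 'a" where
  "x_exponent \<alpha> n e = (\<Sum>i = 1..n. of_int (Poly_Mapping.lookup e i) *\<^sub>R \<alpha> i)"

definition y_exponent :: "(nat \<Rightarrow> 'a::euclidean_space) \<Rightarrow> nat \<Rightarrow> (nat \<Rightarrow>\<^sub>0 int) \<Rightarrow> 'a" where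
  "y_exponent \<alpha> n e = (\<Sum>i = 1..n. of_int (Poly_Mapping.lookup e (n + i)) *\<^sub>R \<alpha> i)"

definition newton_F :: "(nat \<Rightarrow> 'a::euclidean_space) \<Rightarrow> nat \<Rightarrow> laurent fract \<Rightarrow> 'a set" where
  "newton_F \<alpha> n u = convex hull (y_exponent \<alpha> n ` Poly_Mapping.keys (F_polynomial n u))"

definition newton_u :: "(nat \<Rightarrow> 'a::euclidean_space) \<Rightarrow> nat \<Rightarrow> laurent fract \<Rightarrow> ('a \<times> 'a) set" where
  "newton_u \<alpha> n u =
     convex hull
       ((\<lambda>e. (x_exponent \<alpha> n e, y_exponent \<alpha> n e)) ` Poly_Mapping.keys (laurent_expansion u))"

text \<open>Minkowski sums are finite sums in the monoid of sets of theory
  \<^theory>\<open>HOL-Library.Set_Algebras\<close>.\<close>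
definition affine_embedding :: "('a::real_vector \<Rightarrow> 'b::real_vector) \<Rightarrow> bool" where
  "affine_embedding \<phi> \<longleftrightarrow> inj \<phi> \<and> (\<exists>L c. linear L \<and> \<phi> = (\<lambda>v. L v + c))"

end

theory Submission
  imports Defs
begin

text \<open>
  Let \<open>w(I, k)\<close> and \<open>r(I, k)\<close> be the weight and root functions. Flipping a position \<open>i\<close> of a facet
  \<open>I\<close> moves every \<open>w(I, k)\<close> by a nonpositive multiple of \<open>r(I, i)\<close>. Hence, for a functional \<open>f\<close>
  not vanishing on any root, flips along roots with \<open>f r(I, i) < 0\<close> increase all \<open>f w(I, k)\<close> at once
  and end at a facet all of whose roots satisfy \<open>f r(I, i) > 0\<close>. There is only one such facet: this
  is clear when \<open>f\<close> is antidominant, and crossing one wall of the chamber of \<open>f\<close> induces an injection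
  on such facets, because the roots of a facet form a basis. So a single facet maximizes \<open>f w(I, k)\<close>
  for all \<open>k\<close> simultaneously, and the convex hull of the sums \<open>\<Sum>\<^sub>k w(I, k)\<close> is the Minkowski sum of
  the convex hulls.

  For the second part, assign degrees to the variables so that \<open>y\<^sub>j \<Prod>\<^sub>i x\<^sub>i ^ b\<^sub>i\<^sub>j\<close> has degree \<open>0\<close>. Then
  all exchange relations, hence all cluster variables, are homogeneous, so the exponent of \<open>x\<close> in a
  monomial of a cluster variable is a translate of a fixed linear image of the exponent of \<open>y\<close>.
\<close>

section \<open>Root systems and reduced words\<close>

text \<open>The basis property used in crossing walls is itself extracted from the antidominant
  case. A flip preserves the span of the roots of a facet, so improving flips for an antidominant
  functional carry every facet, span unchanged, to the one facet that is unique there. The facet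
  \<open>{1..n}\<close>, whose roots are the simple roots, ends at the same place, so every span is
  the whole space. The weights at the first \<open>n\<close> positions are the same for all facets
  and only translate the brick polytope; the other \<open>N\<close> positions are matched with the
  positive roots by the greedy facet. In the second part, homogeneity is formulated in the fraction
  field, where mutation takes place; the d-vector then supplies a Laurent form of each
  \<open>u \<beta>\<close>. Setting all \<open>x\<close> to 1 could merge or cancel monomials;
  homogeneity excludes this too, since the \<open>y\<close>-exponents determine the
  \<open>x\<close>-exponents. Hence Newton(F) is the projection of Newton(u), and Newton(u) is a
  translated graph over it.\<close>

lemma linear_reflection: "linear (reflection a)"
  by (auto simp: linear_iff reflection_def inner_add_right algebra_simps add_divide_distrib)

lemma reflection_root [simp]: "reflection a a = - a"
  by (cases "a = 0") (simp_all add: reflection_def scaleR_2)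

lemma reflection_uminus [simp]: "reflection (- a) = reflection a"
  by (auto simp: reflection_def)

lemma reflection_involution [simp]: "reflection a (reflection a v) = v"
  by (cases "a = 0") (auto simp: reflection_def inner_diff_right)

lemma reflection_comp_reflection [simp]: "reflection a \<circ> reflection a = id"
  by auto

lemma inner_reflection: "reflection a v \<bullet> w = v \<bullet> reflection a w"
  by (simp add: reflection_def inner_diff_left inner_diff_right inner_commute)

lemma orthogonal_transformation_reflection: "orthogonal_transformation (reflection a)"
  by (metis inner_reflection linear_reflection orthogonal_transformation_def reflection_involution)

lemma reflection_orthogonal_transformation:
  assumes "orthogonal_transformation g"
  shows "g (reflection a v) = reflection (g a) (g v)"
  using assms by (simp add: orthogonal_transformation_def reflection_def linear_diff linear_scale)

lemma orthogonal_transformation_word_act: "orthogonal_transformation (word_act \<alpha> w)"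
  by (induction w)
    (auto simp: word_act_def orthogonal_transformation_id o_def
       dest: orthogonal_transformation_compose[OF orthogonal_transformation_reflection])

lemma linear_word_act: "linear (word_act \<alpha> w)"
  by (rule orthogonal_transformation_linear[OF orthogonal_transformation_word_act])

lemma inner_word_act [simp]: "word_act \<alpha> w x \<bullet> word_act \<alpha> w y = x \<bullet> y"
  using orthogonal_transformation_word_act by (auto simp: orthogonal_transformation_def)

lemma word_act_uminus [simp]: "word_act \<alpha> w (- x) = - word_act \<alpha> w x"
  by (rule linear_neg[OF linear_word_act])

lemma word_act_Nil [simp]: "word_act \<alpha> [] = id"
  by (auto simp: word_act_def)

lemma word_act_Cons: "word_act \<alpha> (i # w) = reflection (\<alpha> i) \<circ> word_act \<alpha> w"
  by (simp add: word_act_def)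

lemma word_act_append: "word_act \<alpha> (v @ w) = word_act \<alpha> v \<circ> word_act \<alpha> w"
  by (induction v) (auto simp: word_act_Cons)

lemma word_act_snoc: "word_act \<alpha> (w @ [i]) = word_act \<alpha> w \<circ> reflection (\<alpha> i)"
  by (simp add: word_act_append word_act_Cons)

lemma word_act_rev_cancel [simp]: "word_act \<alpha> (rev w) (word_act \<alpha> w x) = x"
  by (induction w arbitrary: x) (auto simp: word_act_Cons word_act_append)

lemma word_act_cancel_rev [simp]: "word_act \<alpha> w (word_act \<alpha> (rev w) x) = x"
  using word_act_rev_cancel[of \<alpha> "rev w"] by simp

locale root_basis =
  fixes \<Phi> \<Delta> :: "'a::euclidean_space set" and \<alpha> :: "nat \<Rightarrow> 'a" and n :: nat
  assumes root_system: "crystallographic_root_system \<Phi>"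
    and simple_roots: "simple_system \<Phi> \<Delta>"
    and enumeration: "bij_betw \<alpha> {1..n} \<Delta>"
begin

abbreviation "\<Phi>p \<equiv> positive_roots \<Phi> \<Delta>"
abbreviation "\<omega> \<equiv> fundamental_weight \<alpha> n"
abbreviation "W \<equiv> word_act \<alpha>"

lemma finite_roots: "finite \<Phi>"
  and zero_notin_roots: "0 \<notin> \<Phi>"
  and span_roots: "span \<Phi> = UNIV"
  and reflection_roots: "a \<in> \<Phi> \<Longrightarrow> reflection a ` \<Phi> = \<Phi>"
  and roots_in_line: "a \<in> \<Phi> \<Longrightarrow> \<Phi> \<inter> span {a} = {a, - a}"
  using root_system by (auto simp: crystallographic_root_system_def)

lemma Delta_subset_roots: "\<Delta> \<subseteq> \<Phi>"
  and independent_Delta: "independent \<Delta>"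
  and roots_cases: "b \<in> \<Phi> \<Longrightarrow> nonneg_combination \<Delta> b \<or> nonneg_combination \<Delta> (- b)"
  using simple_roots by (auto simp: simple_system_def)

lemma Delta_eq: "\<Delta> = \<alpha> ` {1..n}"
  using enumeration by (simp add: bij_betw_def)

lemma finite_Delta: "finite \<Delta>"
  by (simp add: Delta_eq)

lemma inj_simple: "inj_on \<alpha> {1..n}"
  using enumeration by (simp add: bij_betw_def)

lemma simple_root_in_roots: "i \<in> {1..n} \<Longrightarrow> \<alpha> i \<in> \<Phi>"
  using Delta_subset_roots Delta_eq by auto

lemma simple_root_nonzero: "i \<in> {1..n} \<Longrightarrow> \<alpha> i \<noteq> 0"
  using simple_root_in_roots zero_notin_roots by metis

lemma span_Delta: "span \<Delta> = UNIV"
proof -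
  have comb: "b \<in> span \<Delta>" if comb: "nonneg_combination \<Delta> b" for b
  proof -
    obtain f where f: "b = (\<Sum>a\<in>\<Delta>. f a *\<^sub>R a)"
      using comb unfolding nonneg_combination_def by blast
    show ?thesis
      unfolding f by (intro span_sum span_scale span_base)
  qed
  have "\<Phi> \<subseteq> span \<Delta>"
  proof
    fix b assume "b \<in> \<Phi>"
    then show "b \<in> span \<Delta>"
      using roots_cases comb span_neg by (metis add.inverse_inverse)
  qed
  then show ?thesis
    using span_roots span_minimal[OF _ subspace_span] by blast
qed

lemma card_eq_DIM: "n = DIM('a)"
proof -
  have "card \<Delta> = DIM('a)"
    using independent_Delta span_Delta basis_card_eq_dim[of \<Delta> UNIV] by simp
  then show ?thesis
    using Delta_eq card_image[OF inj_simple] by simp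
qed

section \<open>Pairings with simple roots and fundamental weights\<close>

lemma eq_if_inner_simple_eq:
  assumes "\<And>i. i \<in> {1..n} \<Longrightarrow> \<alpha> i \<bullet> x = \<alpha> i \<bullet> y"
  shows "x = y"
proof -
  have "z \<bullet> (x - y) = 0" if "z \<in> \<Delta>" for z
    using that assms by (auto simp: Delta_eq inner_diff_right)
  then have "z \<bullet> (x - y) = 0" if "z \<in> span \<Delta>" for z
    using span_induct[OF that, of "\<lambda>z. z \<bullet> (x - y) = 0"]
    by (auto simp: subspace_def inner_add_left)
  then have "(x - y) \<bullet> (x - y) = 0"
    using span_Delta by blast
  then show ?thesis by simp
qed

text \<open>Existence comes from dualising the basis of simple roots and uniqueness from their
  spanning the space, so the definite description denotes.\<close>

lemma fundamental_weight_pairing: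
  assumes "j \<in> {1..n}"
  shows "2 * (\<alpha> j \<bullet> \<omega> i) / (\<alpha> j \<bullet> \<alpha> j) = (if i = j then 1 else 0)"
proof -
  \<comment> \<open>The guard \<open>i \<in> {1..n}\<close> covers indices out of range, whose
    \<open>\<alpha> i\<close> may coincide with a simple root; their weight is 0.\<close>
  obtain g where g: "linear g"
    and gb: "\<And>b. b \<in> \<Delta> \<Longrightarrow> g b = (if b = \<alpha> i \<and> i \<in> {1..n} then (b \<bullet> b) / 2 else (0::real))"
    using linear_independent_extend[OF independent_Delta,
        of "\<lambda>b. if b = \<alpha> i \<and> i \<in> {1..n} then (b \<bullet> b) / 2 else 0"] by auto
  \<comment> \<open>For a real functional \<open>g\<close>, this is the vector that represents
    it.\<close>
  define w where "w = adjoint g 1"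
  have "x \<bullet> w = g x" for x
    unfolding w_def using adjoint_works[OF g, of x 1] by simp
  then have w: "\<forall>j\<in>{1..n}. 2 * (\<alpha> j \<bullet> w) / (\<alpha> j \<bullet> \<alpha> j) = (if i = j then 1 else 0)"
  proof (intro ballI)
    fix j assume j: "j \<in> {1..n}"
    then have "\<alpha> j = \<alpha> i \<and> i \<in> {1..n} \<longleftrightarrow> i = j"
      using inj_simple by (auto dest: inj_onD)
    moreover have "\<alpha> j \<in> \<Delta>" using j by (simp add: Delta_eq)
    ultimately have "\<alpha> j \<bullet> w = (if i = j then (\<alpha> j \<bullet> \<alpha> j) / 2 else 0)"
      using gb[of "\<alpha> j"] \<open>\<And>x. x \<bullet> w = g x\<close> by simp
    then show "2 * (\<alpha> j \<bullet> w) / (\<alpha> j \<bullet> \<alpha> j) = (if i = j then 1 else 0)"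
      using simple_root_nonzero[OF j] by simp
  qed
  have "v = w" if "\<forall>j\<in>{1..n}. 2 * (\<alpha> j \<bullet> v) / (\<alpha> j \<bullet> \<alpha> j) = (if i = j then 1 else 0)" for v
  proof (rule eq_if_inner_simple_eq)
    fix j assume j: "j \<in> {1..n}"
    then have "2 * (\<alpha> j \<bullet> v) / (\<alpha> j \<bullet> \<alpha> j) = 2 * (\<alpha> j \<bullet> w) / (\<alpha> j \<bullet> \<alpha> j)"
      using that w by simp
    then show "\<alpha> j \<bullet> v = \<alpha> j \<bullet> w"
      using simple_root_nonzero[OF j] by simp
  qed
  then have "\<omega> i = w"
    unfolding fundamental_weight_def using w by (intro the_equality) blast+
  then show ?thesis using w assms by blast
qed

lemma inner_simple_weight:
  assumes "j \<in> {1..n}"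
  shows "\<alpha> j \<bullet> \<omega> i = (if i = j then (\<alpha> j \<bullet> \<alpha> j) / 2 else 0)"
  using fundamental_weight_pairing[OF assms, of i] simple_root_nonzero[OF assms]
  by (auto simp: field_simps)

lemma reflection_weight:
  assumes "j \<in> {1..n}" "i \<noteq> j"
  shows "reflection (\<alpha> j) (\<omega> i) = \<omega> i"
  using assms by (simp add: reflection_def inner_simple_weight)

lemma inner_positive_weight:
  assumes "b \<in> \<Phi>p"
  shows "0 \<le> b \<bullet> \<omega> i"
proof -
  obtain f where f: "\<forall>a\<in>\<Delta>. 0 \<le> f a" "b = (\<Sum>a\<in>\<Delta>. f a *\<^sub>R a)"
    using assms by (auto simp: positive_roots_def nonneg_combination_def)
  have "0 \<le> a \<bullet> \<omega> i" if "a \<in> \<Delta>" for a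
    using that by (auto simp: Delta_eq inner_simple_weight)
  then show ?thesis
    using f by (auto simp: inner_sum_left intro!: sum_nonneg)
qed

text \<open>Up to positive factors the fundamental weights are dual to the simple roots, so pairing
  with \<open>\<omega> i\<close> reads off the coefficient at \<open>\<alpha> i\<close>.\<close>

lemma eq_if_inner_weight_eq:
  assumes "\<And>i. i \<in> {1..n} \<Longrightarrow> x \<bullet> \<omega> i = y \<bullet> \<omega> i"
  shows "x = y"
proof -
  obtain f where f: "x - y = (\<Sum>a\<in>\<Delta>. f a *\<^sub>R a)"
  proof -
    have "x - y \<in> range (\<lambda>f. \<Sum>a\<in>\<Delta>. f a *\<^sub>R a)"
      using span_Delta span_finite[OF finite_Delta] by simp
    then show thesis using that by blast
  qed
  have f': "x - y = (\<Sum>j=1..n. f (\<alpha> j) *\<^sub>R \<alpha> j)"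
    unfolding f Delta_eq sum.reindex[OF inj_simple] by simp
  have "f (\<alpha> i) = 0" if i: "i \<in> {1..n}" for i
  proof -
    have "(x - y) \<bullet> \<omega> i = (\<Sum>j=1..n. if i = j then f (\<alpha> j) * (\<alpha> j \<bullet> \<alpha> j) / 2 else 0)"
      unfolding f' inner_sum_left by (intro sum.cong) (auto simp: inner_simple_weight)
    also have "\<dots> = f (\<alpha> i) * (\<alpha> i \<bullet> \<alpha> i) / 2"
      using i by (subst sum.delta') auto
    finally show ?thesis
      using assms[OF i] simple_root_nonzero[OF i] by (simp add: inner_diff_left)
  qed
  then have "x - y = 0"
    unfolding f' by simp
  then show ?thesis by simp
qed

section \<open>Positive roots and simple reflections\<close>

lemma positive_roots_subset: "\<Phi>p \<subseteq> \<Phi>"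
  by (auto simp: positive_roots_def)

lemma finite_positive_roots: "finite \<Phi>p"
  using finite_roots positive_roots_subset finite_subset by blast

lemma simple_root_positive:
  assumes "i \<in> {1..n}"
  shows "\<alpha> i \<in> \<Phi>p"
proof -
  have "\<alpha> i \<in> \<Delta>" using assms by (auto simp: Delta_eq)
  then have "\<alpha> i = (\<Sum>a\<in>\<Delta>. (if a = \<alpha> i then 1 else 0) *\<^sub>R a)"
    using finite_Delta by (simp add: if_distrib[of "\<lambda>x. x *\<^sub>R _"] cong: if_cong)
  then have "nonneg_combination \<Delta> (\<alpha> i)"
    unfolding nonneg_combination_def
    by (intro exI[of _ "\<lambda>a. if a = \<alpha> i then 1 else 0"]) simp
  then show ?thesis
    using simple_root_in_roots[OF assms] by (simp add: positive_roots_def)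
qed

lemma uminus_root: "a \<in> \<Phi> \<Longrightarrow> - a \<in> \<Phi>"
  using roots_in_line by blast

lemma root_positive_or_negative: "a \<in> \<Phi> \<Longrightarrow> a \<in> \<Phi>p \<or> - a \<in> \<Phi>p"
  using roots_cases uminus_root by (auto simp: positive_roots_def)

lemma not_positive_and_negative: "a \<in> \<Phi>p \<Longrightarrow> - a \<notin> \<Phi>p"
proof
  assume a: "a \<in> \<Phi>p" "- a \<in> \<Phi>p"
  then have "a = 0"
    using inner_positive_weight[OF a(1)] inner_positive_weight[OF a(2)]
    by (intro eq_if_inner_weight_eq) (simp add: order_antisym)
  then show False
    using a positive_roots_subset zero_notin_roots by auto
qed

text \<open>Only \<alpha> i lies in \<Phi>p among the multiples of \<alpha> i, so \<open>b\<close>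
  has a positive coefficient at another simple root \<alpha> j. The reflection fixes
  \<open>\<omega> j\<close> and hence keeps this coefficient, and one positive coefficient decides
  the sign of a root.\<close>

lemma simple_reflection_positive:
  assumes i: "i \<in> {1..n}" and b: "b \<in> \<Phi>p" "b \<noteq> \<alpha> i"
  shows "reflection (\<alpha> i) b \<in> \<Phi>p"
proof -
  have "\<exists>j\<in>{1..n}. j \<noteq> i \<and> b \<bullet> \<omega> j \<noteq> 0"
  proof (rule ccontr)
    assume "\<not> ?thesis"
    then have 0: "b \<bullet> \<omega> j = 0" if "j \<in> {1..n}" "j \<noteq> i" for j
      using that by blast
    have "b = (2 * (b \<bullet> \<omega> i) / (\<alpha> i \<bullet> \<alpha> i)) *\<^sub>R \<alpha> i"
      using simple_root_nonzero[OF i] i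
      by (intro eq_if_inner_weight_eq) (auto simp: inner_simple_weight 0)
    then have "b \<in> span {\<alpha> i}"
      by (metis insertI1 span_base span_scale)
    then have "b = - \<alpha> i"
      using b roots_in_line[OF simple_root_in_roots[OF i]] positive_roots_subset by blast
    then show False
      using b not_positive_and_negative simple_root_positive[OF i] by auto
  qed
  then obtain j where j: "j \<in> {1..n}" "j \<noteq> i" "b \<bullet> \<omega> j \<noteq> 0" by blast
  then have "0 < b \<bullet> \<omega> j"
    using inner_positive_weight[OF b(1), of j] by simp
  then have "0 < reflection (\<alpha> i) b \<bullet> \<omega> j"
    using reflection_weight[OF i j(2)] by (simp add: inner_reflection)
  then have "- reflection (\<alpha> i) b \<notin> \<Phi>p"
    using inner_positive_weight[of "- reflection (\<alpha> i) b" j] by auto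
  moreover have "reflection (\<alpha> i) b \<in> \<Phi>"
    using reflection_roots[OF simple_root_in_roots[OF i]] b positive_roots_subset by auto
  ultimately show ?thesis
    using root_positive_or_negative by blast
qed

lemma simple_reflection_image_positive:
  assumes "i \<in> {1..n}"
  shows "reflection (\<alpha> i) ` \<Phi>p = insert (- \<alpha> i) (\<Phi>p - {\<alpha> i})"
proof (intro equalityI subsetI)
  fix x assume "x \<in> reflection (\<alpha> i) ` \<Phi>p"
  then obtain b where b: "b \<in> \<Phi>p" "x = reflection (\<alpha> i) b" by blast
  show "x \<in> insert (- \<alpha> i) (\<Phi>p - {\<alpha> i})"
  proof (cases "b = \<alpha> i")
    case False
    then have "x \<in> \<Phi>p" using simple_reflection_positive[OF assms] b by simp
    moreover have "x \<noteq> \<alpha> i"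
    proof
      assume "x = \<alpha> i"
      then have "b = - \<alpha> i" using b by (metis reflection_involution reflection_root)
      then show False
        using b not_positive_and_negative simple_root_positive[OF assms] by auto
    qed
    ultimately show ?thesis by simp
  qed (use b in simp)
next
  fix x assume x: "x \<in> insert (- \<alpha> i) (\<Phi>p - {\<alpha> i})"
  then have "reflection (\<alpha> i) x \<in> \<Phi>p"
    using simple_reflection_positive[OF assms] simple_root_positive[OF assms]
      linear_neg[OF linear_reflection, of "\<alpha> i" "\<alpha> i"] by auto
  then show "x \<in> reflection (\<alpha> i) ` \<Phi>p"
    by (metis image_eqI reflection_involution)
qed

lemma word_act_image_roots:
  assumes "set w \<subseteq> {1..n}"
  shows "W w ` \<Phi> = \<Phi>"
  using assms
proof (induction w)
  case (Cons i w)
  have "W (i # w) ` \<Phi> = reflection (\<alpha> i) ` (W w ` \<Phi>)"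
    by (simp add: word_act_Cons image_comp)
  then show ?case
    using Cons reflection_roots[OF simple_root_in_roots] by simp
qed simp

lemma word_act_root: "set w \<subseteq> {1..n} \<Longrightarrow> b \<in> \<Phi> \<Longrightarrow> W w b \<in> \<Phi>"
  using word_act_image_roots by blast

lemma positive_on_roots_if_on_simple:
  assumes "linear g" "\<And>i. i \<in> {1..n} \<Longrightarrow> 0 < (g (\<alpha> i) :: real)" "b \<in> \<Phi>p"
  shows "0 < g b"
proof -
  obtain f where f: "\<forall>a\<in>\<Delta>. 0 \<le> f a" "b = (\<Sum>a\<in>\<Delta>. f a *\<^sub>R a)"
    using assms by (auto simp: positive_roots_def nonneg_combination_def)
  have g: "g b = (\<Sum>a\<in>\<Delta>. f a * g a)"
    by (simp add: f linear_sum[OF assms(1)] linear_scale[OF assms(1)])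
  have pos: "0 < g a" if "a \<in> \<Delta>" for a
    using that assms(2) by (auto simp: Delta_eq)
  have "\<exists>a\<in>\<Delta>. f a \<noteq> 0"
  proof (rule ccontr)
    assume "\<not> ?thesis"
    then have "b = 0" using f by simp
    then show False using assms(3) positive_roots_subset zero_notin_roots by auto
  qed
  then obtain a where "a \<in> \<Delta>" "0 < f a" using f by force
  then have "0 < (\<Sum>a\<in>\<Delta>. f a * g a)"
    using f(1) pos finite_Delta
    by (intro sum_pos2[of _ a]) (auto intro!: mult_nonneg_nonneg less_imp_le[OF pos])
  then show ?thesis using g by simp
qed

lemma exists_dominant: "\<exists>h. \<forall>b\<in>\<Phi>p. 0 < h \<bullet> b"
proof -
  \<comment> \<open>The Weyl vector; it pairs with each simple root to half the squared length of
    that root.\<close>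
  let ?h = "\<Sum>i=1..n. \<omega> i"
  have "0 < ?h \<bullet> \<alpha> j" if j: "j \<in> {1..n}" for j
  proof -
    have "?h \<bullet> \<alpha> j = (\<Sum>i=1..n. if i = j then (\<alpha> j \<bullet> \<alpha> j) / 2 else 0)"
      unfolding inner_sum_left
      by (intro sum.cong) (use j in \<open>auto simp: inner_commute[of _ "\<alpha> j"] inner_simple_weight\<close>)
    also have "\<dots> = (\<alpha> j \<bullet> \<alpha> j) / 2"
      using j by (subst sum.delta) auto
    finally have "?h \<bullet> \<alpha> j = (\<alpha> j \<bullet> \<alpha> j) / 2" .
    moreover have "0 < \<alpha> j \<bullet> \<alpha> j"
      using simple_root_nonzero[OF j] by simp
    ultimately show ?thesis by linarith
  qed
  then have "0 < ?h \<bullet> b" if "b \<in> \<Phi>p" for b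
    using positive_on_roots_if_on_simple[of "(\<bullet>) ?h" b] that
      bounded_linear.linear[OF bounded_linear_inner_right] by blast
  then show ?thesis by blast
qed

text \<open>An element of the orbit making the most positive roots negative makes all of them negative.\<close>
lemma exists_word_antidominant:
  assumes generic: "\<And>b. b \<in> \<Phi> \<Longrightarrow> f \<bullet> b \<noteq> 0"
  shows "\<exists>w. set w \<subseteq> {1..n} \<and> (\<forall>b\<in>\<Phi>p. f \<bullet> W w b < 0)"
proof -
  define neg where "neg w = {b\<in>\<Phi>p. f \<bullet> W w b < 0}" for w
  have bd: "card (neg w) \<le> card \<Phi>p" for w
    unfolding neg_def by (rule card_mono[OF finite_positive_roots]) auto
  obtain w where w: "set w \<subseteq> {1..n}"
    and max: "\<And>v. set v \<subseteq> {1..n} \<Longrightarrow> card (neg v) \<le> card (neg w)"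
    using ex_has_greatest_nat[of "\<lambda>w. set w \<subseteq> {1..n}" "[]" "\<lambda>w. card (neg w)" "Suc (card \<Phi>p)"] bd
    by (metis empty_subsetI less_Suc_eq_le list.set(1))
  have "f \<bullet> W w (\<alpha> j) < 0" if j: "j \<in> {1..n}" for j
  proof (rule ccontr)
    assume "\<not> ?thesis"
    moreover have "f \<bullet> W w (\<alpha> j) \<noteq> 0"
      using generic word_act_root[OF w simple_root_in_roots[OF j]] by blast
    ultimately have pos: "0 < f \<bullet> W w (\<alpha> j)" by linarith
    \<comment> \<open>Appending \<open>j\<close> turns \<alpha> j negative and merely permutes the
      roots that were negative already, contradicting maximality.\<close>
    have "insert (\<alpha> j) (reflection (\<alpha> j) ` neg w) \<subseteq> neg (w @ [j])"
    proof
      fix x assume "x \<in> insert (\<alpha> j) (reflection (\<alpha> j) ` neg w)"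
      then consider "x = \<alpha> j" | b where "b \<in> neg w" "x = reflection (\<alpha> j) b" by blast
      then show "x \<in> neg (w @ [j])"
      proof cases
        case 1
        then show ?thesis
          using pos simple_root_positive[OF j] by (simp add: neg_def word_act_snoc)
      next
        case 2
        then have "b \<noteq> \<alpha> j" using pos by (auto simp: neg_def)
        then show ?thesis
          using 2 simple_reflection_positive[OF j] by (simp add: neg_def word_act_snoc)
      qed
    qed
    moreover have "\<alpha> j \<notin> reflection (\<alpha> j) ` neg w"
    proof
      assume "\<alpha> j \<in> reflection (\<alpha> j) ` neg w"
      then have "- \<alpha> j \<in> \<Phi>p"
        by (metis (no_types, lifting) imageE mem_Collect_eq neg_def reflection_involution reflection_root)
      then show False using not_positive_and_negative simple_root_positive[OF j] by blast
    qed
    moreover have "inj_on (reflection (\<alpha> j)) (neg w)"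
      by (metis inj_onI reflection_involution)
    moreover have "finite (neg v)" for v
      unfolding neg_def using finite_positive_roots by simp
    ultimately have "Suc (card (neg w)) \<le> card (neg (w @ [j]))"
      by (metis card_image card_insert_disjoint card_mono finite_imageI)
    then show False
      using max[of "w @ [j]"] w j by simp
  qed
  then have "0 < - (f \<bullet> W w b)" if "b \<in> \<Phi>p" for b
  proof -
    have "linear (\<lambda>b. - (f \<bullet> W w b))"
      using linear_word_act[of \<alpha> w] by (auto simp: linear_iff inner_add_right)
    then show ?thesis
      using positive_on_roots_if_on_simple that \<open>\<And>j. j \<in> {1..n} \<Longrightarrow> f \<bullet> W w (\<alpha> j) < 0\<close>
      by (metis neg_0_less_iff_less)
  qed
  then show ?thesis using w by force
qed

subsection \<open>The longest element\<close>

text \<open>Applying the inverse of \<open>w\<close> letter by letter must change the sign of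
  \<open>b\<close> somewhere, and a simple reflection changes the sign of no positive root but its
  own.\<close>

lemma root_crossing:
  assumes "set w \<subseteq> {1..n}" "b \<in> \<Phi>p" "- W (rev w) b \<in> \<Phi>p"
  shows "\<exists>k<length w. b = W (take k w) (\<alpha> (w ! k))"
  using assms
proof (induction w arbitrary: b)
  case Nil
  then show ?case using not_positive_and_negative by simp
next
  case (Cons i w)
  then have i: "i \<in> {1..n}" by simp
  show ?case
  proof (cases "b = \<alpha> i")
    case True
    then show ?thesis by (intro exI[of _ 0]) simp
  next
    case False
    then have "reflection (\<alpha> i) b \<in> \<Phi>p"
      using simple_reflection_positive[OF i] Cons by blast
    then obtain k where "k < length w" "reflection (\<alpha> i) b = W (take k w) (\<alpha> (w ! k))"
      using Cons by (auto simp: word_act_append word_act_Cons)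
    then have "b = W (take (Suc k) (i # w)) (\<alpha> ((i # w) ! Suc k))"
      by (metis comp_apply nth_Cons_Suc reflection_involution take_Suc_Cons word_act_Cons)
    then show ?thesis
      using \<open>k < length w\<close> by (intro exI[of _ "Suc k"]) simp
  qed
qed

text \<open>At the letter \<open>i\<close> where the root turns negative, the remaining word maps
  \<alpha> j to \<alpha> i. It therefore conjugates the reflection in \<alpha> j to the one in
  \<alpha> i, and the letter \<open>i\<close> cancels against the appended \<open>j\<close>.\<close>

lemma exchange:
  assumes "set w \<subseteq> {1..n}" "j \<in> {1..n}" "- W w (\<alpha> j) \<in> \<Phi>p"
  shows "\<exists>v. set v \<subseteq> {1..n} \<and> Suc (length v) = length w \<and> W v = W (w @ [j])"
  using assms
proof (induction w)
  case Nil
  then show ?case using not_positive_and_negative simple_root_positive by auto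
next
  case (Cons i w)
  then have i: "i \<in> {1..n}" and w: "set w \<subseteq> {1..n}" by auto
  show ?case
  proof (cases "- W w (\<alpha> j) \<in> \<Phi>p")
    case True
    then obtain v where v: "set v \<subseteq> {1..n}" "Suc (length v) = length w" "W v = W (w @ [j])"
      using Cons by auto
    then show ?thesis
      using i by (intro exI[of _ "i # v"]) (auto simp: word_act_Cons)
  next
    case False
    then have "W w (\<alpha> j) \<in> \<Phi>p"
      using root_positive_or_negative word_act_root[OF w simple_root_in_roots] Cons by blast
    moreover have "reflection (\<alpha> i) (W w (\<alpha> j)) \<notin> \<Phi>p"
      using Cons.prems not_positive_and_negative[of "reflection (\<alpha> i) (W w (\<alpha> j))"]
      by (auto simp: word_act_Cons)
    ultimately have eq: "W w (\<alpha> j) = \<alpha> i"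
      using simple_reflection_positive[OF i] by blast
    have "W ((i # w) @ [j]) x = W w x" for x
      using reflection_orthogonal_transformation[OF orthogonal_transformation_word_act, of \<alpha> w "\<alpha> j" x]
      by (simp add: word_act_Cons word_act_append eq)
    then have "W w = W ((i # w) @ [j])" by (intro ext) simp
    then show ?thesis using w by (intro exI[of _ w]) simp
  qed
qed

text \<open>If \<open>w\<close> ends in \<open>j\<close> and keeps \<alpha> j positive, then the
  word before \<open>j\<close> makes \<alpha> j negative. The exchange property then yields a word
  for the same element that is shorter by two letters.\<close>

lemma word_act_trivial:
  assumes "set w \<subseteq> {1..n}" "\<And>b. b \<in> \<Phi>p \<Longrightarrow> W w b \<in> \<Phi>p"
  shows "W w = id"
  using assms
proof (induction w rule: length_induct)
  case (1 w)
  show ?case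
  proof (cases w rule: rev_cases)
    case (snoc v j)
    then have v: "set v \<subseteq> {1..n}" and j: "j \<in> {1..n}" using 1 by auto
    have "- W v (\<alpha> j) \<in> \<Phi>p"
      using 1(3)[OF simple_root_positive[OF j]] by (simp add: snoc word_act_snoc)
    then obtain u where "set u \<subseteq> {1..n}" "Suc (length u) = length v" "W u = W w"
      using exchange[OF v j] snoc by metis
    then show ?thesis
      using 1 snoc by (metis Suc_lessD lessI length_append_singleton)
  qed simp
qed

definition inversions :: "nat list \<Rightarrow> 'a set" where
  "inversions w = {b\<in>\<Phi>p. - W w b \<in> \<Phi>p}"

lemma finite_inversions: "finite (inversions w)"
  unfolding inversions_def using finite_positive_roots by simp

lemma card_inversions_le: "card (inversions w) \<le> card \<Phi>p"
  unfolding inversions_def by (rule card_mono[OF finite_positive_roots]) auto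

lemma card_inversions_le_length:
  assumes "set w \<subseteq> {1..n}"
  shows "card (inversions w) \<le> length w"
proof -
  have "inversions w \<subseteq> (\<lambda>k. W (take k (rev w)) (\<alpha> (rev w ! k))) ` {..<length w}"
    using root_crossing[of "rev w"] assms by (fastforce simp: inversions_def)
  then have "card (inversions w) \<le> card {..<length w}"
    by (meson surj_card_le finite_lessThan)
  then show ?thesis by simp
qed

lemma inversions_snoc:
  assumes w: "set w \<subseteq> {1..n}" and j: "j \<in> {1..n}" and neg: "- W w (\<alpha> j) \<in> \<Phi>p"
  shows "inversions w = insert (\<alpha> j) (reflection (\<alpha> j) ` inversions (w @ [j]))"
proof (intro equalityI subsetI)
  fix x assume x: "x \<in> inversions w"
  show "x \<in> insert (\<alpha> j) (reflection (\<alpha> j) ` inversions (w @ [j]))"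
  proof (cases "x = \<alpha> j")
    case False
    then have "reflection (\<alpha> j) x \<in> inversions (w @ [j])"
      using x simple_reflection_positive[OF j] by (simp add: inversions_def word_act_snoc)
    then show ?thesis by (metis imageI insertCI reflection_involution)
  qed simp
next
  fix x assume "x \<in> insert (\<alpha> j) (reflection (\<alpha> j) ` inversions (w @ [j]))"
  then consider "x = \<alpha> j" | b where "b \<in> inversions (w @ [j])" "x = reflection (\<alpha> j) b" by blast
  then show "x \<in> inversions w"
  proof cases
    case 1
    then show ?thesis using neg simple_root_positive[OF j] by (simp add: inversions_def)
  next
    case 2
    then have "b \<noteq> \<alpha> j"
      using neg not_positive_and_negative by (auto simp: inversions_def word_act_snoc)
    then show ?thesis
      using 2 simple_reflection_positive[OF j] by (simp add: inversions_def word_act_snoc)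
  qed
qed

lemma card_inversions_snoc:
  assumes w: "set w \<subseteq> {1..n}" and j: "j \<in> {1..n}" and neg: "- W w (\<alpha> j) \<in> \<Phi>p"
  shows "card (inversions w) = Suc (card (inversions (w @ [j])))"
proof -
  have "\<alpha> j \<notin> reflection (\<alpha> j) ` inversions (w @ [j])"
  proof
    assume "\<alpha> j \<in> reflection (\<alpha> j) ` inversions (w @ [j])"
    then have "- \<alpha> j \<in> \<Phi>p"
      by (metis (no_types, lifting) imageE inversions_def mem_Collect_eq reflection_involution reflection_root)
    then show False using not_positive_and_negative simple_root_positive[OF j] by blast
  qed
  moreover have "inj_on (reflection (\<alpha> j)) A" for A
    by (metis inj_onI reflection_involution)
  ultimately show ?thesis
    unfolding inversions_snoc[OF assms]
    by (subst card_insert_disjoint) (auto simp: card_image finite_inversions)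
qed

text \<open>Unless there are no inversions, some simple root is inverted; appending its letter
  removes one inversion, and the same letter undoes this at the end.\<close>

lemma exists_word_of_inversion_length:
  assumes "set w \<subseteq> {1..n}"
  shows "\<exists>v. set v \<subseteq> {1..n} \<and> length v = card (inversions w) \<and> W v = W w"
  using assms
proof (induction "card (inversions w)" arbitrary: w)
  case 0
  then have "inversions w = {}" using finite_inversions by simp
  then have "W w b \<in> \<Phi>p" if "b \<in> \<Phi>p" for b
    using that root_positive_or_negative word_act_root[OF 0(2)] positive_roots_subset
    by (auto simp: inversions_def)
  then have "W w = id" using word_act_trivial[OF 0(2)] by blast
  then show ?case using 0 by (intro exI[of _ "[]"]) simp
next
  case (Suc k)
  have "\<exists>j\<in>{1..n}. - W w (\<alpha> j) \<in> \<Phi>p"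
  proof (rule ccontr)
    assume "\<not> ?thesis"
    then have pos: "W w (\<alpha> j) \<in> \<Phi>p" if "j \<in> {1..n}" for j
      using that root_positive_or_negative word_act_root[OF Suc(3) simple_root_in_roots] by blast
    obtain h where h: "\<forall>b\<in>\<Phi>p. 0 < h \<bullet> b" using exists_dominant by blast
    have "linear (\<lambda>b. h \<bullet> W w b)"
      using linear_word_act[of \<alpha> w] by (auto simp: linear_iff inner_add_right)
    then have "0 < h \<bullet> W w b" if "b \<in> \<Phi>p" for b
      using positive_on_roots_if_on_simple that pos h by blast
    then have "inversions w = {}"
      using h by (force simp: inversions_def)
    then show False using Suc by simp
  qed
  then obtain j where j: "j \<in> {1..n}" "- W w (\<alpha> j) \<in> \<Phi>p" by blast
  then have c: "card (inversions w) = Suc (card (inversions (w @ [j])))"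
    using card_inversions_snoc Suc by blast
  then obtain v where "set v \<subseteq> {1..n}" "length v = card (inversions (w @ [j]))" "W v = W (w @ [j])"
    using Suc(1)[of "w @ [j]"] Suc(2,3) j by auto
  then show ?case
    using c j by (intro exI[of _ "v @ [j]"]) (auto simp: word_act_snoc comp_assoc)
qed

lemma coxeter_length_word_act:
  assumes "set w \<subseteq> {1..n}"
  shows "coxeter_length \<alpha> n (W w) = card (inversions w)"
  unfolding coxeter_length_def
proof (rule Least_equality)
  show "\<exists>v. set v \<subseteq> {1..n} \<and> length v = card (inversions w) \<and> W v = W w"
    using exists_word_of_inversion_length[OF assms] .
next
  fix l assume "\<exists>v. set v \<subseteq> {1..n} \<and> length v = l \<and> W v = W w"
  then show "card (inversions w) \<le> l"
    using card_inversions_le_length by (force simp: inversions_def)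
qed

definition inverts_all :: "('a \<Rightarrow> 'a) \<Rightarrow> bool" where
  "inverts_all g \<longleftrightarrow> (\<forall>b\<in>\<Phi>p. - g b \<in> \<Phi>p)"

lemma inverts_all_iff_card: "inverts_all (W w) \<longleftrightarrow> card (inversions w) = card \<Phi>p"
proof
  assume "inverts_all (W w)"
  then show "card (inversions w) = card \<Phi>p"
    by (auto simp: inverts_all_def inversions_def intro!: arg_cong[of _ _ card])
next
  assume "card (inversions w) = card \<Phi>p"
  then have "inversions w = \<Phi>p"
    using card_subset_eq[OF finite_positive_roots] by (simp add: inversions_def)
  then show "inverts_all (W w)" by (auto simp: inverts_all_def inversions_def)
qed

lemma exists_inverts_all: "\<exists>w. set w \<subseteq> {1..n} \<and> inverts_all (W w)"
proof -
  obtain h where h: "\<forall>b\<in>\<Phi>p. 0 < h \<bullet> b" using exists_dominant by blast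
  have "h \<bullet> b \<noteq> 0" if "b \<in> \<Phi>" for b
    using root_positive_or_negative[OF that] h by fastforce
  then obtain w where w: "set w \<subseteq> {1..n}" "\<forall>b\<in>\<Phi>p. h \<bullet> W w b < 0"
    using exists_word_antidominant by blast
  have "- W w b \<in> \<Phi>p" if "b \<in> \<Phi>p" for b
    using root_positive_or_negative[OF word_act_root[OF w(1)]] that positive_roots_subset w(2) h
    by (meson in_mono less_asym')
  then show ?thesis using w by (auto simp: inverts_all_def)
qed

text \<open>\<open>rev v\<close> spells the inverse of \<open>W v\<close>, so
  \<open>rev v @ w\<close> inverts signs twice and preserves the positive roots.\<close>

lemma inverts_all_unique:
  assumes "set v \<subseteq> {1..n}" "inverts_all (W v)" "set w \<subseteq> {1..n}" "inverts_all (W w)"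
  shows "W v = W w"
proof -
  have "W (rev v @ w) b \<in> \<Phi>p" if b: "b \<in> \<Phi>p" for b
  proof (rule ccontr)
    assume "W (rev v @ w) b \<notin> \<Phi>p"
    then have "- W (rev v @ w) b \<in> \<Phi>p"
      using root_positive_or_negative word_act_root[of "rev v @ w" b] assms b positive_roots_subset by auto
    then have "- W v (- W (rev v @ w) b) \<in> \<Phi>p"
      using assms by (auto simp: inverts_all_def)
    then have "W w b \<in> \<Phi>p" by (simp add: word_act_append)
    then show False
      using assms(4) b not_positive_and_negative by (auto simp: inverts_all_def)
  qed
  then have "W (rev v @ w) = id"
    using word_act_trivial[of "rev v @ w"] assms by auto
  then have "W v (W (rev v @ w) x) = W v x" for x by simp
  then show ?thesis by (auto simp: word_act_append)
qed

lemma longest_element_eq: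
  assumes w: "set w \<subseteq> {1..n}" "inverts_all (W w)"
  shows "longest_element \<alpha> n = W w"
  unfolding longest_element_def
proof (rule the_equality)
  have len: "coxeter_length \<alpha> n (W w) = card \<Phi>p"
    using w coxeter_length_word_act inverts_all_iff_card by simp
  then show "W w \<in> coxeter_group \<alpha> n \<and>
      (\<forall>h\<in>coxeter_group \<alpha> n. coxeter_length \<alpha> n h \<le> coxeter_length \<alpha> n (W w))"
    using w coxeter_length_word_act card_inversions_le by (auto simp: coxeter_group_def)
  fix g assume g: "g \<in> coxeter_group \<alpha> n \<and>
      (\<forall>h\<in>coxeter_group \<alpha> n. coxeter_length \<alpha> n h \<le> coxeter_length \<alpha> n g)"
  then obtain v where v: "set v \<subseteq> {1..n}" "g = W v"
    by (auto simp: coxeter_group_def)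
  have "W w \<in> coxeter_group \<alpha> n" using w by (auto simp: coxeter_group_def)
  then have "card \<Phi>p \<le> coxeter_length \<alpha> n g" using g len by force
  then have "card (inversions v) = card \<Phi>p"
    using v coxeter_length_word_act card_inversions_le by (simp add: order_antisym)
  then show "g = W w"
    using v w inverts_all_unique inverts_all_iff_card by metis
qed

text \<open>Turns reducedness into a sign condition and a count of letters, the form in which facets
  are handled below.\<close>

lemma reduced_word_longest_iff:
  "reduced_word \<alpha> n (longest_element \<alpha> n) v \<longleftrightarrow>
     set v \<subseteq> {1..n} \<and> inverts_all (W v) \<and> length v = card \<Phi>p"
proof -
  obtain w where w: "set w \<subseteq> {1..n}" "inverts_all (W w)" using exists_inverts_all by blast
  then have "coxeter_length \<alpha> n (W w) = card \<Phi>p"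
    using coxeter_length_word_act inverts_all_iff_card by simp
  then show ?thesis
    unfolding reduced_word_def longest_element_eq[OF w] using w inverts_all_unique by metis
qed

lemma exists_reduced_word_longest: "\<exists>v. reduced_word \<alpha> n (longest_element \<alpha> n) v"
  using exists_inverts_all exists_word_of_inversion_length inverts_all_iff_card
  unfolding reduced_word_longest_iff by metis

end

section \<open>Lexicographic minima\<close>

lemma lex_first_eqI:
  assumes "I \<in> \<I>" "\<And>J. J \<in> \<I> \<Longrightarrow> J \<noteq> I \<Longrightarrow> lex_less I J"
  shows "lex_first \<I> = I"
  unfolding lex_first_def
proof (rule the_equality)
  show "I \<in> \<I> \<and> (\<forall>J\<in>\<I>. J \<noteq> I \<longrightarrow> lex_less I J)"
    using assms by blast
  have asym: "asym (lexord {(x, y). x < (y::nat)})"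
    by (rule lexord_asym) (auto intro: asymI)
  fix I' assume "I' \<in> \<I> \<and> (\<forall>J\<in>\<I>. J \<noteq> I' \<longrightarrow> lex_less I' J)"
  then show "I' = I"
    using assms asymD[OF asym] unfolding lex_less_def by metis
qed

lemma lex_less_linear:
  assumes "finite I" "finite J" "I \<noteq> J"
  shows "lex_less I J \<or> lex_less J I"
proof -
  have "sorted_list_of_set I \<noteq> sorted_list_of_set J"
    using assms by (metis sorted_list_of_set.set_sorted_key_list_of_set)
  then show ?thesis
    unfolding lex_less_def
    using lexord_linear[of "{(x, y). x < (y::nat)}" "sorted_list_of_set I" "sorted_list_of_set J"]
      linorder_less_linear by auto
qed

text \<open>\<open>lexord\<close> is not well-founded on lists of varying length. Sets of equal
  cardinality give lists of equal length, on which it agrees with the well-founded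
  \<open>lex\<close>; this matters because the family may be infinite.\<close>

lemma lex_first_in:
  assumes "\<I> \<noteq> {}" and fin: "\<And>I. I \<in> \<I> \<Longrightarrow> finite I \<and> card I = l"
  shows "lex_first \<I> \<in> \<I>"
proof -
  have "wf (inv_image (lex {(x, y). x < (y::nat)}) sorted_list_of_set)"
    by (intro wf_inv_image wf_lex wf)
  then obtain I where I: "I \<in> \<I>"
    and min: "\<And>J. (J, I) \<in> inv_image (lex {(x, y). x < (y::nat)}) sorted_list_of_set \<Longrightarrow> J \<notin> \<I>"
    using assms(1) by (metis ex_in_conv wfE_min)
  have "\<not> lex_less J I" if "J \<in> \<I>" for J
    using min[of J] that fin[OF that] fin[OF I] unfolding lex_less_def by (auto simp: lexord_lex)
  then have "lex_first \<I> = I"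
    using I fin lex_less_linear by (intro lex_first_eqI) metis+
  then show ?thesis using I by simp
qed

lemma lex_less_initial_segment:
  assumes J: "finite J" "card J = n" "0 \<notin> J" "J \<noteq> {1..n}"
  shows "lex_less {1..n} J"
proof (rule ccontr)
  assume "\<not> ?thesis"
  then have "lex_less J {1..n}"
    using lex_less_linear[of J "{1..n}"] J by auto
  moreover define xs where "xs = sorted_list_of_set J"
  moreover have "sorted_list_of_set {1..n} = [1..<Suc n]"
    by (simp flip: atLeastLessThanSuc_atLeastAtMost del: upt_Suc)
  ultimately have "(xs, [1..<Suc n]) \<in> lexord {(x, y). x < y}"
    by (simp add: lex_less_def)
  moreover have len: "length xs = n" unfolding xs_def using J by simp
  ultimately obtain i where i: "i < n" "xs ! i < [1..<Suc n] ! i"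
    unfolding lexord_take_index_conv by (auto simp del: upt_Suc)
  have "sorted_wrt (<) xs"
    unfolding xs_def by (rule sorted_list_of_set.strict_sorted_key_list_of_set)
  \<comment> \<open>List indices start at 0 and positions at 1: the entries are strictly increasing
    and positive.\<close>
  have "Suc k \<le> xs ! k" if "k < n" for k
    using that
  proof (induction k)
    case 0
    then have "xs ! 0 \<in> J" using len J(1) unfolding xs_def by (metis nth_mem set_sorted_list_of_set)
    then show ?case using J(3) by (metis Suc_leI gr0I)
  next
    case (Suc k)
    then have "xs ! k < xs ! Suc k"
      using sorted_wrt_nth_less[OF \<open>sorted_wrt (<) xs\<close>] len by simp
    then show ?case using Suc by simp
  qed
  then show False using i by (auto simp del: upt_Suc simp: nth_upt not_less[symmetric])
qed

lemma subword_insert_max: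
  assumes "finite P" "\<And>y. y \<in> P \<Longrightarrow> y < x"
  shows "subword q (insert x P) = subword q P @ [q x]"
proof -
  have "x \<notin> P" using assms(2) by blast
  then have "sorted_list_of_set (insert x P) = insort x (sorted_list_of_set P)"
    using assms(1) by simp
  also have "\<dots> = sorted_list_of_set P @ [x]"
    using assms by (intro sorted_insort_is_snoc) (auto intro: less_imp_le)
  finally show ?thesis by (simp add: subword_def)
qed

lemma subword_empty [simp]: "subword q {} = []"
  by (simp add: subword_def)

lemma set_subword: "finite P \<Longrightarrow> set (subword q P) = q ` P"
  by (simp add: subword_def)

lemma length_subword: "length (subword q P) = card P"
  by (simp add: subword_def)

lemma exists_periodic_subword:
  assumes "set v \<subseteq> {1..n}"
  shows "\<exists>P. finite P \<and> subword (periodic_letter n) P = v \<and> (\<forall>p\<in>P. p < length v * n)"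
  using assms
proof (induction v rule: rev_induct)
  case (snoc j v)
  then obtain P where P: "finite P" "subword (periodic_letter n) P = v" "\<forall>p\<in>P. p < length v * n"
    by auto
  \<comment> \<open>The letter \<open>j\<close> is taken from the next copy of the period; the shift
    by one matches the \<open>+ 1\<close> in \<open>periodic_letter\<close>.\<close>
  let ?x = "length v * n + (j - 1)"
  have j: "1 \<le> j" "j \<le> n" using snoc by auto
  have "subword (periodic_letter n) (insert ?x P) = v @ [periodic_letter n ?x]"
    using P by (subst subword_insert_max) force+
  moreover have "periodic_letter n ?x = j"
    using j by (cases j) (simp_all add: periodic_letter_def)
  ultimately show ?case
    using P j by (intro exI[of _ "insert ?x P"]) force
next
  case Nil
  show ?case by (intro exI[of _ "{}"]) simp
qed

section \<open>The subword complex of \<open>c w\<^sub>\<circ>(c)\<close>\<close>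

context root_basis
begin

abbreviation "N \<equiv> card \<Phi>p"
abbreviation "Q \<equiv> Q_letter \<alpha> n"
abbreviation "pp \<equiv> prefix_product \<alpha> n"
abbreviation "r \<equiv> root_function \<alpha> n"
abbreviation "wt \<equiv> weight_function \<alpha> n"
abbreviation "F \<equiv> facets \<alpha> n"

lemma sorting_word_reduced: "reduced_word \<alpha> n (longest_element \<alpha> n) (sorting_word \<alpha> n)"
proof -
  let ?\<P> = "{P. finite P \<and>
    reduced_word \<alpha> n (longest_element \<alpha> n) (subword (periodic_letter n) P)}"
  obtain v where v: "reduced_word \<alpha> n (longest_element \<alpha> n) v"
    using exists_reduced_word_longest by blast
  then have "set v \<subseteq> {1..n}" by (simp add: reduced_word_def)
  then have "?\<P> \<noteq> {}"
    using v exists_periodic_subword[of v n] by auto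
  moreover have "finite P \<and> card P = N" if "P \<in> ?\<P>" for P
    using that by (auto simp: reduced_word_longest_iff length_subword)
  ultimately have "lex_first ?\<P> \<in> ?\<P>" by (rule lex_first_in)
  then show ?thesis by (simp add: sorting_word_def)
qed

lemma length_sorting_word: "length (sorting_word \<alpha> n) = N"
  and set_sorting_word: "set (sorting_word \<alpha> n) \<subseteq> {1..n}"
  using sorting_word_reduced by (auto simp: reduced_word_longest_iff)

lemma length_Q_word: "length (Q_word \<alpha> n) = n + N"
  by (simp add: Q_word_def length_sorting_word)

lemma Q_letter_initial: "k \<in> {1..n} \<Longrightarrow> Q k = k"
  by (auto simp: Q_letter_def Q_word_def nth_append simp del: upt_Suc)

lemma Q_letter_in: "k \<in> {1..n + N} \<Longrightarrow> Q k \<in> {1..n}"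
proof -
  assume "k \<in> {1..n + N}"
  then have "Q k \<in> set (Q_word \<alpha> n)"
    unfolding Q_letter_def by (intro nth_mem) (auto simp: length_Q_word)
  also have "set (Q_word \<alpha> n) \<subseteq> {1..n}"
    using set_sorting_word by (auto simp: Q_word_def)
  finally show ?thesis .
qed

section \<open>Prefix products and signs of roots\<close>

lemma pp_1 [simp]: "pp I (Suc 0) = id"
  by (simp add: prefix_product_def)

lemma pp_Suc:
  assumes "1 \<le> k"
  shows "pp I (Suc k) = (if k \<in> I then pp I k else pp I k \<circ> reflection (\<alpha> (Q k)))"
proof (cases "k \<in> I")
  case True
  then have "{1..<Suc k} - I = {1..<k} - I" by (auto simp: less_Suc_eq)
  then show ?thesis using True by (simp add: prefix_product_def)
next
  case False
  then have "{1..<Suc k} - I = insert k ({1..<k} - I)" using assms by auto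
  moreover have "subword Q (insert k ({1..<k} - I)) = subword Q ({1..<k} - I) @ [Q k]"
    by (rule subword_insert_max) auto
  ultimately show ?thesis
    using False by (simp add: prefix_product_def word_act_snoc)
qed

lemma pp_letters: "k \<le> Suc (n + N) \<Longrightarrow> set (subword Q ({1..<k} - I)) \<subseteq> {1..n}"
  using Q_letter_in by (auto simp: set_subword simp del: atLeastAtMost_iff intro!: Q_letter_in) auto

lemma orthogonal_transformation_pp: "orthogonal_transformation (pp I k)"
  by (simp add: prefix_product_def orthogonal_transformation_word_act)

lemma inner_pp [simp]: "pp I k x \<bullet> pp I k y = x \<bullet> y"
  by (simp add: prefix_product_def)

lemma pp_uminus [simp]: "pp I k (- x) = - pp I k x"
  by (simp add: prefix_product_def)

lemma pp_inj: "pp I k x = pp I k y \<longleftrightarrow> x = y"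
  by (metis prefix_product_def word_act_rev_cancel)

lemma root_function_in_roots:
  assumes "k \<in> {1..n + N}"
  shows "r I k \<in> \<Phi>"
  using assms word_act_root[OF pp_letters[of k I] simple_root_in_roots[OF Q_letter_in]]
  by (simp add: root_function_def prefix_product_def)

text \<open>An isometry conjugates a reflection to the reflection in the image vector. So keeping
  the letter at \<open>k\<close> amounts to multiplying by the reflection in \<open>r I k\<close>
  from the left.\<close>

lemma pp_reflection: "pp I k \<circ> reflection (\<alpha> (Q k)) = reflection (r I k) \<circ> pp I k"
  using reflection_orthogonal_transformation[OF orthogonal_transformation_pp]
  by (auto simp: root_function_def)

lemma facets_iff:
  "I \<in> F \<longleftrightarrow> I \<subseteq> {1..n + N} \<and> card I = n \<and> inverts_all (pp I (Suc (n + N)))"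
proof -
  have "{1..<Suc (n + N)} = {1..n + N}" by auto
  moreover have "card ({1..n + N} - I) = N" if "I \<subseteq> {1..n + N}" "card I = n"
    using that by (subst card_Diff_subset) (auto intro: finite_subset)
  ultimately show ?thesis
    using pp_letters[of "Suc (n + N)" I]
    by (auto simp: facets_def length_Q_word reduced_word_longest_iff length_subword prefix_product_def)
qed

lemma finite_facets: "finite F"
  by (rule finite_subset[of _ "Pow {1..n + N}"]) (use facets_iff in blast, simp)

text \<open>The image of the positive system under the prefix product records the sign of each root
  relative to the position.\<close>
definition pos_at :: "nat set \<Rightarrow> nat \<Rightarrow> 'a set" where
  "pos_at I k = pp I k ` \<Phi>p"

lemma pos_at_1 [simp]: "pos_at I (Suc 0) = \<Phi>p"
  by (simp add: pos_at_def)

text \<open>The image under \<open>pp I k\<close> of the fact that a simple reflection changes the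
  sign of its own root alone.\<close>

lemma pos_at_Suc:
  assumes "k \<in> {1..n + N}"
  shows "pos_at I (Suc k) =
    (if k \<in> I then pos_at I k else insert (- r I k) (pos_at I k - {r I k}))"
proof (cases "k \<in> I")
  case True
  then show ?thesis using assms by (simp add: pos_at_def pp_Suc)
next
  case False
  have "pos_at I (Suc k) = pp I k ` (reflection (\<alpha> (Q k)) ` \<Phi>p)"
    using False assms by (simp add: pos_at_def pp_Suc image_comp)
  also have "\<dots> = insert (- r I k) (pos_at I k - {r I k})"
    unfolding simple_reflection_image_positive[OF Q_letter_in[OF assms]]
    by (auto simp: pos_at_def root_function_def pp_inj)
  finally show ?thesis using False by simp
qed

lemma root_function_pos_at: "k \<in> {1..n + N} \<Longrightarrow> r I k \<in> pos_at I k"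
  using simple_root_positive Q_letter_in by (auto simp: pos_at_def root_function_def)

lemma pos_at_not_uminus: "x \<in> pos_at I k \<Longrightarrow> - x \<notin> pos_at I k"
proof
  assume "x \<in> pos_at I k" "- x \<in> pos_at I k"
  then obtain y z where yz: "y \<in> \<Phi>p" "x = pp I k y" "z \<in> \<Phi>p" "- x = pp I k z"
    by (auto simp: pos_at_def)
  then have "pp I k z = pp I k (- y)" by simp
  then have "z = - y" by (simp only: pp_inj)
  then show False using yz not_positive_and_negative by blast
qed

lemma pos_at_end:
  assumes "I \<in> F" "b \<in> \<Phi>p"
  shows "b \<notin> pos_at I (Suc (n + N))"
proof
  assume "b \<in> pos_at I (Suc (n + N))"
  then obtain g where g: "g \<in> \<Phi>p" "b = pp I (Suc (n + N)) g"
    by (auto simp: pos_at_def)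
  then have "- b \<in> \<Phi>p"
    using assms(1) by (auto simp: facets_iff inverts_all_def)
  then show False using assms(2) not_positive_and_negative by blast
qed

text \<open>All positive roots start with a positive sign and end with a negative one, and only a
  position outside \<open>I\<close> with root \<open>b\<close> can change the sign of
  \<open>b\<close>.\<close>

lemma positive_root_occurs:
  assumes "I \<in> F" "b \<in> \<Phi>p"
  shows "\<exists>j\<in>{1..n + N} - I. r I j = b"
proof (rule ccontr)
  assume no: "\<not> ?thesis"
  have "b \<in> pos_at I (Suc k)" if "k \<le> n + N" for k
    using that
  proof (induction k)
    case (Suc k)
    then show ?case using no pos_at_Suc[of "Suc k" I] by auto
  qed (use assms in simp)
  then show False using pos_at_end[OF assms] by blast
qed

text \<open>There are exactly \<open>N\<close> positions outside \<open>I\<close>, so the surjection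
  just found is a bijection.\<close>

lemma bij_betw_root_function:
  assumes "I \<in> F"
  shows "bij_betw (r I) ({1..n + N} - I) \<Phi>p"
proof -
  let ?C = "{1..n + N} - I"
  have card: "card ?C = N"
    using assms by (subst card_Diff_subset) (auto simp: facets_iff intro: finite_subset)
  have sub: "\<Phi>p \<subseteq> r I ` ?C" using positive_root_occurs[OF assms] by blast
  moreover have "card (r I ` ?C) \<le> N" using card_image_le[of ?C "r I"] card by simp
  ultimately have "r I ` ?C = \<Phi>p"
    by (metis card_seteq finite_Diff finite_atLeastAtMost finite_imageI)
  then show ?thesis
    using card eq_card_imp_inj_on[of ?C "r I"] by (simp add: bij_betw_def)
qed

text \<open>By injectivity the sign of \<open>r I j\<close> changes only at \<open>j\<close>; this
  lemma and the next one record it on either side.\<close>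

lemma pos_at_before:
  assumes "I \<in> F" "j \<in> {1..n + N} - I" "1 \<le> k" "k \<le> j"
  shows "r I j \<in> pos_at I k"
  using assms(3,4)
proof (induction k rule: nat_induct_at_least)
  case base
  then show ?case using bij_betwE[OF bij_betw_root_function] assms by simp
next
  case (Suc k)
  have "r I k \<noteq> r I j" if "k \<notin> I"
    using bij_betw_imp_inj_on[OF bij_betw_root_function[OF assms(1)]] Suc assms that
    by (auto dest!: inj_onD)
  then show ?case using Suc assms by (auto simp: pos_at_Suc)
qed

lemma pos_at_after:
  assumes "I \<in> F" "j \<in> {1..n + N} - I" "j < k" "k \<le> Suc (n + N)"
  shows "- r I j \<in> pos_at I k"
proof -
  have "Suc j \<le> k" using assms by simp
  then show ?thesis using assms(4)
  proof (induction k rule: nat_induct_at_least)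
    case base
    then show ?case using assms by (simp add: pos_at_Suc)
  next
    case (Suc k)
    then have k: "k \<in> {1..n + N}" by simp
    have "r I k \<noteq> - r I j" if "k \<notin> I"
      using bij_betwE[OF bij_betw_root_function[OF assms(1)]] k assms(2) that not_positive_and_negative
      by (metis Diff_iff)
    then show ?case using Suc k by (auto simp: pos_at_Suc[OF k])
  qed
qed

subsection \<open>Flips\<close>

text \<open>The two roots agree up to sign, so omitting either letter removes the same reflection.
  The prefix products differ by it between the two positions, and the difference cancels at the
  later one.\<close>

lemma pp_exchange:
  assumes i: "i \<in> I" and j: "j \<notin> I" and ij: "1 \<le> i" "1 \<le> j"
    and eq: "r I j = r I i \<or> r I j = - r I i"
    and J: "J = insert j (I - {i})" and k: "1 \<le> k"
  shows "pp J k = (if min i j < k \<and> k \<le> max i j then reflection (r I i) \<circ> pp I k else pp I k)"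
  using k
proof (induction k rule: nat_induct_at_least)
  case base
  then show ?case using ij by (simp add: min_def)
next
  case (Suc k)
  let ?R = "reflection (r I i)"
  have "i \<noteq> j" using i j by blast
  have R: "reflection (r I j) = ?R" using eq by auto
  have RR: "?R \<circ> (?R \<circ> g) = g" for g :: "'a \<Rightarrow> 'a"
    by (simp flip: comp_assoc)
  consider "k = i" | "k = j" | "k \<noteq> i" "k \<noteq> j" by blast
  then show ?case
  proof cases
    case 1
    have "pp I i (reflection (\<alpha> (Q i)) a) = ?R (pp I i a)" for a
      using pp_reflection[of I i] by (metis comp_apply)
    then show ?thesis
      using 1 Suc i J \<open>i \<noteq> j\<close>
      by (auto simp: pp_Suc min_def max_def split: if_splits)
  next
    case 2
    then show ?thesis
      using Suc j J \<open>i \<noteq> j\<close> pp_reflection[of I j]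
      by (auto simp: pp_Suc comp_assoc R RR min_def max_def split: if_splits)
  next
    case 3
    then have "k \<in> J \<longleftrightarrow> k \<in> I" using J by auto
    moreover have "min i j < Suc k \<and> Suc k \<le> max i j \<longleftrightarrow> min i j < k \<and> k \<le> max i j"
      using 3 by auto
    ultimately show ?thesis using Suc by (auto simp: pp_Suc)
  qed
qed

text \<open>Since \<open>r I j\<close> is a positive root, the last conjunct says that the flip goes
  to the right if \<open>r I i\<close> is positive and to the left if it is negative.\<close>

definition flip :: "nat set \<Rightarrow> nat \<Rightarrow> nat \<Rightarrow> nat set \<Rightarrow> bool" where
  "flip I i j J \<longleftrightarrow> I \<in> F \<and> J \<in> F \<and> i \<in> I \<and> j \<in> {1..n + N} - I \<and> J = insert j (I - {i}) \<and>
     (i < j \<and> r I j = r I i \<or> j < i \<and> r I j = - r I i)"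

text \<open>The positive one of \<open>r I i\<close> and \<open>- r I i\<close> occurs at some
  \<open>j\<close> outside \<open>I\<close>. As \<open>r I i\<close> has positive sign at
  \<open>i\<close> itself, the side of \<open>i\<close> on which this sign change lies is
  forced.\<close>

lemma exists_flip:
  assumes I: "I \<in> F" and i: "i \<in> I"
  shows "\<exists>j J. flip I i j J"
proof -
  have i': "i \<in> {1..n + N}" using I i by (auto simp: facets_iff)
  obtain j where j: "j \<in> {1..n + N} - I"
    and c: "i < j \<and> r I j = r I i \<or> j < i \<and> r I j = - r I i"
  proof (cases "r I i \<in> \<Phi>p")
    case True
    then obtain j where j: "j \<in> {1..n + N} - I" "r I j = r I i"
      using positive_root_occurs[OF I] by blast
    then have "\<not> j < i"
      using pos_at_after[OF I j(1), of i] root_function_pos_at[OF i', of I] pos_at_not_uminus i'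
      by auto
    then show ?thesis using that j i by (metis DiffD2 nat_neq_iff)
  next
    case False
    then have "- r I i \<in> \<Phi>p"
      using root_positive_or_negative root_function_in_roots[OF i'] by blast
    then obtain j where j: "j \<in> {1..n + N} - I" "r I j = - r I i"
      using positive_root_occurs[OF I] by blast
    then have "\<not> i < j"
      using pos_at_before[OF I j(1), of i] root_function_pos_at[OF i', of I] pos_at_not_uminus i'
      by auto
    then show ?thesis using that j i by (metis DiffD2 nat_neq_iff)
  qed
  define J where "J = insert j (I - {i})"
  have fin: "finite I" using I by (auto simp: facets_iff intro: finite_subset)
  have "card J = card I"
    unfolding J_def using fin i j
    by (metis DiffD2 Diff_iff card.insert card_Suc_Diff1 finite_Diff)
  moreover have "pp J (Suc (n + N)) = pp I (Suc (n + N))"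
    using pp_exchange[OF i _ _ _ _ J_def, of "Suc (n + N)"] i' j c by auto
  ultimately have "J \<in> F"
    using I i' j by (auto simp: facets_iff J_def)
  then show ?thesis
    using I i j c J_def unfolding flip_def by blast
qed

context
  fixes I i j J assumes flip: "flip I i j J"
begin

lemma flip_positions: "i \<in> {1..n + N}" "j \<in> {1..n + N}" "i \<noteq> j"
  using flip by (auto simp: flip_def facets_iff)

lemma pp_flip:
  "1 \<le> k \<Longrightarrow>
    pp J k = (if min i j < k \<and> k \<le> max i j then reflection (r I i) \<circ> pp I k else pp I k)"
  using flip flip_positions by (intro pp_exchange) (auto simp: flip_def)

lemma root_function_flip:
  "1 \<le> k \<Longrightarrow>
    r J k = (if min i j < k \<and> k \<le> max i j then reflection (r I i) (r I k) else r I k)"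
  by (simp add: root_function_def pp_flip)

lemma root_function_flip_new: "r J j = - r I i"
  using flip flip_positions root_function_flip[of j]
  by (auto simp: flip_def min_def max_def)

lemma root_function_flip_old:
  "r J i \<in> \<Phi>p" "r J i = r I i \<or> r J i = - r I i"
proof -
  have "r I j \<in> \<Phi>p"
    using flip bij_betwE[OF bij_betw_root_function] by (auto simp: flip_def)
  moreover have "r J i = r I j"
    using flip flip_positions root_function_flip[of i] by (auto simp: flip_def min_def max_def)
  ultimately show "r J i \<in> \<Phi>p" "r J i = r I i \<or> r J i = - r I i"
    using flip by (auto simp: flip_def)
qed

lemma flip_root_pos_at:
  assumes "min i j < k" "k \<le> max i j"
  shows "r I i \<in> pos_at I k"
  using flip
proof (unfold flip_def, elim conjE disjE)
  assume "I \<in> F" "j \<in> {1..n + N} - I" "i < j" "r I j = r I i"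
  then show ?thesis
    using pos_at_before[of I j k] assms by auto
next
  assume "I \<in> F" "j \<in> {1..n + N} - I" "j < i" "r I j = - r I i"
  then show ?thesis
    using pos_at_after[of I j k] assms flip_positions by auto
qed

text \<open>Between the two positions \<open>r I i\<close> has positive sign, hence is the image of
  a positive root, and positive roots pair nonnegatively with fundamental weights. Strictness at one
  position is what makes improving flips terminate.\<close>

lemma weight_flip:
  assumes k: "k \<in> {1..n + N}"
  shows "\<exists>c\<ge>0. wt J k = wt I k - c *\<^sub>R r I i \<and> (k = max i j \<longrightarrow> 0 < c)"
proof (cases "min i j < k \<and> k \<le> max i j")
  case False
  then have "wt J k = wt I k" "k \<noteq> max i j"
    using k flip_positions by (auto simp: weight_function_def pp_flip)
  then show ?thesis by (intro exI[of _ 0]) simp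
next
  case True
  let ?b = "r I i"
  define c where "c = 2 * (?b \<bullet> wt I k) / (?b \<bullet> ?b)"
  have eq: "wt J k = wt I k - c *\<^sub>R ?b"
    using True k by (simp add: weight_function_def pp_flip reflection_def c_def)
  obtain g where g: "g \<in> \<Phi>p" "?b = pp I k g"
    using flip_root_pos_at True by (auto simp: pos_at_def)
  have pair: "?b \<bullet> wt I k = g \<bullet> \<omega> (Q k)"
    using g by (simp add: weight_function_def)
  have "0 < ?b \<bullet> ?b"
    using root_function_in_roots[OF flip_positions(1), of I] zero_notin_roots by auto
  then have "0 \<le> c"
    unfolding c_def pair using inner_positive_weight[OF g(1)] by simp
  moreover have "0 < c" if "k = max i j"
  proof -
    \<comment> \<open>At the later position the preimage of the flipped root is the simple root
      itself, which pairs positively with its own weight.\<close>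
    have "?b = r I k"
      using flip that by (auto simp: flip_def max_def)
    then have "g = \<alpha> (Q k)" using g by (simp add: root_function_def pp_inj)
    moreover have "0 < \<alpha> (Q k) \<bullet> \<alpha> (Q k)"
      using simple_root_nonzero[OF Q_letter_in[OF k]] by simp
    ultimately show ?thesis
      unfolding c_def pair using \<open>0 < ?b \<bullet> ?b\<close> inner_simple_weight[OF Q_letter_in[OF k]] by simp
  qed
  ultimately show ?thesis using eq by blast
qed

text \<open>The root at a common position changes at most by a multiple of \<open>r I i\<close>, and
  the new position carries \<open>- r I i\<close>.\<close>

lemma span_flip: "span (r J ` J) = span (r I ` I)"
proof -
  have J: "J = insert j (I - {i})" and i: "i \<in> I" using flip by (auto simp: flip_def)
  have ge: "1 \<le> k" if "k \<in> I \<or> k \<in> J" for k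
    using that flip by (auto simp: flip_def facets_iff)
  have r: "\<exists>c. r J k = r I k - c *\<^sub>R r I i" if k: "k \<in> I" for k
  proof (cases "min i j < k \<and> k \<le> max i j")
    case True
    then have "r J k = reflection (r I i) (r I k)"
      using root_function_flip[of k] ge k by simp
    then show ?thesis unfolding reflection_def by blast
  next
    case False
    then have "r J k = r I k - 0 *\<^sub>R r I i"
      using root_function_flip[of k] ge k by auto
    then show ?thesis by blast
  qed
  have "r J k \<in> span (r I ` I)" if "k \<in> J" for k
  proof (cases "k = j")
    case True
    then show ?thesis using i root_function_flip_new by (simp add: span_neg span_base)
  next
    case False
    then have "k \<in> I" using that J by blast
    then obtain c where "r J k = r I k - c *\<^sub>R r I i" using r by blast
    then show ?thesis
      using \<open>k \<in> I\<close> i by (simp add: span_diff span_scale span_base)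
  qed
  moreover have "r I k \<in> span (r J ` J)" if k: "k \<in> I" for k
  proof -
    have "- r I i \<in> span (r J ` J)"
      using root_function_flip_new J by (metis image_eqI insertI1 span_base)
    then have *: "r I i \<in> span (r J ` J)" by (metis add.inverse_inverse span_neg)
    show ?thesis
    proof (cases "k = i")
      case False
      obtain c where "r J k = r I k - c *\<^sub>R r I i" using r[OF k] by blast
      then have "r I k = r J k + c *\<^sub>R r I i" by simp
      moreover have "k \<in> J" using False k J by blast
      ultimately show ?thesis
        using * by (simp add: span_add span_scale span_base)
    qed (use * in simp)
  qed
  ultimately show ?thesis
    by (metis (no_types, lifting) image_subset_iff span_mono span_span subset_antisym)
qed

end

subsection \<open>Facets and linear functionals\<close>

definition generic :: "'a \<Rightarrow> bool" where
  "generic f \<longleftrightarrow> (\<forall>b\<in>\<Phi>. f \<bullet> b \<noteq> 0)"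

text \<open>Instead of following a chain of flips, one takes a facet maximizing the total
  \<open>g\<close> among those at least as good as \<open>J\<close> in every position. A further
  improving flip would raise \<open>g\<close> strictly.\<close>

lemma exists_improving_facet:
  assumes f: "generic f" and J: "J \<in> F"
  shows "\<exists>I\<in>F. (\<forall>i\<in>I. 0 < f \<bullet> r I i) \<and> (\<forall>k\<in>{1..n + N}. f \<bullet> wt J k \<le> f \<bullet> wt I k) \<and>
    span (r I ` I) = span (r J ` J)"
proof -
  define S where "S = {I \<in> F. (\<forall>k\<in>{1..n + N}. f \<bullet> wt J k \<le> f \<bullet> wt I k) \<and>
    span (r I ` I) = span (r J ` J)}"
  define g where "g I = (\<Sum>k=1..n + N. f \<bullet> wt I k)" for I
  have "finite S" "S \<noteq> {}" using finite_facets J by (auto simp: S_def)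
  then obtain I where "is_arg_min (\<lambda>I. - g I) (\<lambda>I. I \<in> S) I"
    using ex_is_arg_min_if_finite by blast
  then have I: "I \<in> S" and max: "\<And>I'. I' \<in> S \<Longrightarrow> g I' \<le> g I"
    by (auto simp: is_arg_min_def not_less)
  have "0 < f \<bullet> r I i" if i: "i \<in> I" for i
  proof (rule ccontr)
    assume "\<not> ?thesis"
    moreover have "i \<in> {1..n + N}" using I i by (auto simp: S_def facets_iff)
    ultimately have neg: "f \<bullet> r I i < 0"
      using f root_function_in_roots[of i I] by (force simp: generic_def)
    obtain j I' where flip: "flip I i j I'"
      using exists_flip[of I i] I i unfolding S_def by blast
    have le: "f \<bullet> wt I k \<le> f \<bullet> wt I' k \<and> (k = max i j \<longrightarrow> f \<bullet> wt I k < f \<bullet> wt I' k)"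
      if k: "k \<in> {1..n + N}" for k
    proof -
      obtain c where c: "0 \<le> c" "wt I' k = wt I k - c *\<^sub>R r I i" "k = max i j \<longrightarrow> 0 < c"
        using weight_flip[OF flip k] by blast
      have "c * (f \<bullet> r I i) \<le> 0" "0 < c \<longrightarrow> c * (f \<bullet> r I i) < 0"
        using c(1) neg by (auto simp: mult_nonneg_nonpos mult_pos_neg)
      then show ?thesis using c by (auto simp: inner_diff_right)
    qed
    have "f \<bullet> wt J k \<le> f \<bullet> wt I' k" if k: "k \<in> {1..n + N}" for k
    proof -
      have "f \<bullet> wt J k \<le> f \<bullet> wt I k" using I k by (simp add: S_def)
      then show ?thesis using le[OF k] by linarith
    qed
    then have "I' \<in> S"
      using I span_flip[OF flip] flip unfolding S_def flip_def by blast
    moreover have "max i j \<in> {1..n + N}"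
      using flip_positions[OF flip] by (auto simp: max_def)
    then have "\<exists>k\<in>{1..n + N}. f \<bullet> wt I k < f \<bullet> wt I' k"
      using le by blast
    then have "g I < g I'"
      unfolding g_def using le by (intro sum_strict_mono_ex1) auto
    ultimately show False using max by force
  qed
  then show ?thesis using I by (auto simp: S_def)
qed

text \<open>Reading from left to right, the signs determine which positions belong to the facet.\<close>
lemma negative_facet_unique:
  assumes "I \<in> F" "\<And>i. i \<in> I \<Longrightarrow> - r I i \<in> \<Phi>p"
    and "J \<in> F" "\<And>i. i \<in> J \<Longrightarrow> - r J i \<in> \<Phi>p"
  shows "I = J"
proof -
  \<comment> \<open>Positions outside a facet always carry positive roots, so here the sign of the
    root detects membership.\<close>
  have mem: "k \<in> I \<longleftrightarrow> - r I k \<in> \<Phi>p"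
    if "I \<in> F" "\<And>i. i \<in> I \<Longrightarrow> - r I i \<in> \<Phi>p" "k \<in> {1..n + N}" for I k
    using that bij_betwE[OF bij_betw_root_function[OF that(1)]] not_positive_and_negative by blast
  have eq: "pp I (Suc k) = pp J (Suc k)" if "k \<le> n + N" for k
    using that
  proof (induction k)
    case (Suc k)
    then have k: "Suc k \<in> {1..n + N}" by simp
    have "r I (Suc k) = r J (Suc k)"
      using Suc by (simp add: root_function_def)
    then have "Suc k \<in> I \<longleftrightarrow> Suc k \<in> J"
      using mem[OF assms(1,2) k] mem[OF assms(3,4) k] by simp
    then show ?case using Suc by (auto simp: pp_Suc)
  qed simp
  have "k \<in> I \<longleftrightarrow> k \<in> J" if k: "k \<in> {1..n + N}" for k
  proof -
    obtain l where l: "k = Suc l" "l \<le> n + N" using k by (cases k) auto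
    have "r I k = r J k" using eq[OF l(2)] l by (simp add: root_function_def)
    then show ?thesis using mem[OF assms(1,2) k] mem[OF assms(3,4) k] by simp
  qed
  then show ?thesis
    using assms(1,3) unfolding facets_iff by blast
qed

lemma pp_initial: "k \<le> Suc n \<Longrightarrow> pp {1..n} k = id"
proof -
  assume "k \<le> Suc n"
  then have "{1..<k} - {1..n} = {}" by auto
  then show ?thesis
    by (simp only: prefix_product_def subword_empty word_act_Nil)
qed

lemma initial_facet: "{1..n} \<in> F"
proof -
  have "subword Q {Suc n..<Suc (n + N)} = sorting_word \<alpha> n"
  proof (rule nth_equalityI)
    show len: "length (subword Q {Suc n..<Suc (n + N)}) = length (sorting_word \<alpha> n)"
      by (simp add: length_subword length_sorting_word)
    fix k assume "k < length (subword Q {Suc n..<Suc (n + N)})"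
    then show "subword Q {Suc n..<Suc (n + N)} ! k = sorting_word \<alpha> n ! k"
      by (simp add: subword_def Q_letter_def Q_word_def nth_append del: upt_Suc)
  qed
  moreover have "{1..<Suc (n + N)} - {1..n} = {Suc n..<Suc (n + N)}" by auto
  ultimately have "pp {1..n} (Suc (n + N)) = W (sorting_word \<alpha> n)"
    by (simp add: prefix_product_def)
  then show ?thesis
    using sorting_word_reduced by (simp add: facets_iff reduced_word_longest_iff)
qed

lemma greedy_facet_eq: "greedy_facet \<alpha> n = {1..n}"
  unfolding greedy_facet_def
proof (rule lex_first_eqI[OF initial_facet])
  fix J assume "J \<in> F" "J \<noteq> {1..n}"
  then show "lex_less {1..n} J"
    by (intro lex_less_initial_segment) (auto simp: facets_iff intro: finite_subset)
qed

text \<open>Improving flips for \<open>- h\<close> take both this facet and \<open>{1..n}\<close> to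
  the facet with only negative roots, preserving spans.\<close>

lemma span_root_configuration:
  assumes "I \<in> F"
  shows "span (r I ` I) = UNIV"
proof -
  obtain h where h: "\<forall>b\<in>\<Phi>p. 0 < h \<bullet> b" using exists_dominant by blast
  have generic: "generic (- h)"
    unfolding generic_def using root_positive_or_negative h by force
  have neg: "- r J i \<in> \<Phi>p" if J: "J \<in> F" "\<forall>i\<in>J. 0 < (- h) \<bullet> r J i" "i \<in> J" for J i
  proof -
    have "i \<in> {1..n + N}" using J by (auto simp: facets_iff)
    then have "r J i \<in> \<Phi>p \<or> - r J i \<in> \<Phi>p"
      using root_positive_or_negative root_function_in_roots by blast
    then show ?thesis using h J by force
  qed
  obtain J where J: "J \<in> F" "\<forall>i\<in>J. 0 < (- h) \<bullet> r J i" "span (r J ` J) = span (r I ` I)"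
    using exists_improving_facet[OF generic assms] by blast
  obtain J' where J': "J' \<in> F" "\<forall>i\<in>J'. 0 < (- h) \<bullet> r J' i"
    "span (r J' ` J') = span (r {1..n} ` {1..n})"
    using exists_improving_facet[OF generic initial_facet] by blast
  have "J = J'"
    using J J' neg by (intro negative_facet_unique) auto
  moreover have "r {1..n} ` {1..n} = \<Delta>"
    unfolding Delta_eq
    by (intro image_cong)
      (auto simp: root_function_def pp_initial Q_letter_initial simp del: One_nat_def)
  ultimately show ?thesis using J J' span_Delta by simp
qed

lemma inj_root_configuration:
  assumes "I \<in> F"
  shows "inj_on (r I) I"
proof -
  have fin: "finite I" "card I = n" using assms by (auto simp: facets_iff intro: finite_subset)
  then have "DIM('a) \<le> card (r I ` I)"
    using span_root_configuration[OF assms] span_card_ge_dim[of "r I ` I" UNIV] by simp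
  then show ?thesis
    using fin card_eq_DIM card_image_le[of I "r I"] by (intro eq_card_imp_inj_on) auto
qed

text \<open>The functionals that are negative on \<open>W w\<close> of the positive roots form an
  open chamber, antidominant for the empty word. The condition says that the roots of
  \<open>I\<close> are positive on it, without choosing a functional.\<close>

definition in_chamber :: "nat list \<Rightarrow> nat set \<Rightarrow> bool" where
  "in_chamber w I \<longleftrightarrow> I \<in> F \<and> (\<forall>i\<in>I. \<exists>b\<in>\<Phi>p. r I i = - W w b)"

text \<open>Adjacent chambers disagree only about the sign of \<open>W w (\<alpha> s)\<close>. If it
  is a root of the facet, flipping there replaces it by its negative.\<close>

lemma in_chamber_cross:
  assumes s: "s \<in> {1..n}" and I: "in_chamber (w @ [s]) I"
  shows "if W w (\<alpha> s) \<in> r I ` I then \<exists>i j J. in_chamber w J \<and> flip I i j J \<and> r I i = W w (\<alpha> s)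
    else in_chamber w I"
proof -
  let ?g = "W w (\<alpha> s)"
  have neg: "\<exists>b'\<in>\<Phi>p. x = - W w b'" if "b \<in> \<Phi>p" "x = - W (w @ [s]) b" "x \<noteq> ?g" for x b
  proof -
    have "b \<noteq> \<alpha> s" using that by (auto simp: word_act_snoc)
    then show ?thesis
      using that simple_reflection_positive[OF s] by (auto simp: word_act_snoc)
  qed
  show ?thesis
  proof (cases "?g \<in> r I ` I")
    case False
    then show ?thesis using I neg unfolding in_chamber_def by (metis imageI)
  next
    case True
    then obtain i where i: "i \<in> I" "r I i = ?g" by force
    then obtain j J where flip: "flip I i j J"
      using exists_flip I unfolding in_chamber_def by blast
    have J: "J \<in> F" "J = insert j (I - {i})" using flip by (auto simp: flip_def)
    have "\<exists>b\<in>\<Phi>p. r J k = - W w b" if k: "k \<in> J" for k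
    proof (cases "k = j")
      case True
      then show ?thesis
        using root_function_flip_new[OF flip] i simple_root_positive[OF s] by auto
    next
      case False
      then have kI: "k \<in> I" "k \<noteq> i" using k J by auto
      then obtain b where b: "b \<in> \<Phi>p" "r I k = - W (w @ [s]) b"
        using I unfolding in_chamber_def by blast
      \<comment> \<open>The roots of a facet are distinct, so all others keep their sign across the
        wall, whether or not the flip reflects them.\<close>
      have "r I k \<noteq> ?g"
        using inj_root_configuration[of I] I kI i unfolding in_chamber_def by (metis inj_onD)
      then have "b \<noteq> \<alpha> s" using b by (auto simp: word_act_snoc)
      have "reflection ?g (r I k) = - W w b"
        using b reflection_orthogonal_transformation[OF orthogonal_transformation_word_act, of \<alpha> w "\<alpha> s"]
        by (simp add: word_act_snoc flip: word_act_uminus linear_neg[OF linear_reflection])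
      moreover have "r I k = - W w (reflection (\<alpha> s) b)"
        using b by (simp add: word_act_snoc)
      moreover have "1 \<le> k" using kI I by (auto simp: in_chamber_def facets_iff)
      ultimately show ?thesis
        using root_function_flip[OF flip, of k] i b simple_reflection_positive[OF s b(1) \<open>b \<noteq> \<alpha> s\<close>]
        by metis
    qed
    then have "in_chamber w J" using J by (simp add: in_chamber_def)
    then show ?thesis using flip i True by auto
  qed
qed

text \<open>Crossing the last wall sends both facets to the same facet \<open>K\<close> by
  induction; what remains is to recover each of them from \<open>K\<close>.\<close>

lemma in_chamber_unique:
  assumes "set w \<subseteq> {1..n}" "in_chamber w I" "in_chamber w J"
  shows "I = J"
  using assms
proof (induction w arbitrary: I J rule: rev_induct)
  case Nil
  then show ?case
    by (intro negative_facet_unique) (auto simp: in_chamber_def)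
next
  case (snoc s w)
  let ?g = "W w (\<alpha> s)"
  have s: "s \<in> {1..n}" and w: "set w \<subseteq> {1..n}" using snoc by auto
  \<comment> \<open>This and \<open>new\<close> rule out that exactly one of the facets is flipped:
    a flipped facet acquires the root \<open>- ?g\<close>, which an unflipped one cannot
    have.\<close>
  have no: "- ?g \<notin> r I ` I" if I: "in_chamber (w @ [s]) I" for I
  proof
    assume "- ?g \<in> r I ` I"
    then obtain b where b: "b \<in> \<Phi>p" "- ?g = - W (w @ [s]) b"
      using I unfolding in_chamber_def by force
    then have "?g = W w (reflection (\<alpha> s) b)" by (simp add: word_act_snoc)
    then have "reflection (\<alpha> s) b = \<alpha> s"
      by (metis word_act_rev_cancel)
    then have "b = - \<alpha> s" by (metis reflection_involution reflection_root)
    then show False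
      using b(1) not_positive_and_negative simple_root_positive[OF s] by blast
  qed
  have new: "- ?g \<in> r J ` J" if "flip I i j J" "r I i = ?g" for I i j J
    using that root_function_flip_new[OF that(1)] by (force simp: flip_def)
  note cross = in_chamber_cross[OF s]
  show ?case
  proof (cases "?g \<in> r I ` I"; cases "?g \<in> r J ` J")
    assume "?g \<notin> r I ` I" "?g \<notin> r J ` J"
    then have "in_chamber w I" "in_chamber w J"
      using cross[OF snoc.prems(2)] cross[OF snoc.prems(3)] by auto
    then show ?thesis using snoc.IH[OF w] by blast
  next
    assume "?g \<notin> r I ` I" "?g \<in> r J ` J"
    then obtain i j K where "in_chamber w I" "in_chamber w K" "flip J i j K" "r J i = ?g"
      using cross[OF snoc.prems(2)] cross[OF snoc.prems(3)] by auto
    moreover from this have "I = K" using snoc.IH[OF w] by blast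
    ultimately show ?thesis
      using new[of J i j K] no[OF snoc.prems(2)] by blast
  next
    assume "?g \<in> r I ` I" "?g \<notin> r J ` J"
    then obtain i j K where "in_chamber w J" "in_chamber w K" "flip I i j K" "r I i = ?g"
      using cross[OF snoc.prems(2)] cross[OF snoc.prems(3)] by auto
    moreover from this have "J = K" using snoc.IH[OF w] by blast
    ultimately show ?thesis
      using new[of I i j K] no[OF snoc.prems(3)] by blast
  next
    assume "?g \<in> r I ` I" "?g \<in> r J ` J"
    then obtain i j K i' j' K' where K: "in_chamber w K" "flip I i j K" "r I i = ?g"
      and K': "in_chamber w K'" "flip J i' j' K'" "r J i' = ?g"
      using cross[OF snoc.prems(2)] cross[OF snoc.prems(3)] by auto
    have "K' = K" using K K' snoc.IH[OF w] by blast
    note K' = K'[unfolded this]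
    have KF: "K \<in> F" and KI: "K = insert j (I - {i})" "i \<in> I" "j \<notin> I"
      and KJ: "K = insert j' (J - {i'})" "i' \<in> J" "j' \<notin> J"
      using K(2) K'(2) by (auto simp: flip_def)
    \<comment> \<open>The position flipped in is the one of \<open>K\<close> with root
      \<open>- ?g\<close>, by the basis property. The position flipped out is the one outside
      \<open>K\<close> whose root is \<open>?g\<close> up to sign, by the bijection with positive
      roots.\<close>
    have "r K j = r K j'"
      using root_function_flip_new[OF K(2)] root_function_flip_new[OF K'(2)] K K' by simp
    then have j: "j = j'"
      using inj_root_configuration[OF KF] KI KJ by (metis inj_onD insertI1)
    have "r K i = r K i'"
      using root_function_flip_old[OF K(2)] root_function_flip_old[OF K'(2)] K(3) K'(3)
        not_positive_and_negative by metis
    moreover have "i \<in> {1..n + N} - K" "i' \<in> {1..n + N} - K"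
      using flip_positions[OF K(2)] flip_positions[OF K'(2)] KI KJ by auto
    ultimately have "i = i'"
      using bij_betw_imp_inj_on[OF bij_betw_root_function[OF KF]] by (metis inj_onD)
    moreover have "I = insert i (K - {j})" "J = insert i' (K - {j'})"
      using KI KJ by auto
    ultimately show ?thesis using j by simp
  qed
qed

lemma exists_dominating_facet:
  assumes f: "generic f"
  shows "\<exists>I\<in>F. \<forall>J\<in>F. \<forall>k\<in>{1..n + N}. f \<bullet> wt J k \<le> f \<bullet> wt I k"
proof -
  obtain w where w: "set w \<subseteq> {1..n}" "\<forall>b\<in>\<Phi>p. f \<bullet> W w b < 0"
    using exists_word_antidominant f unfolding generic_def by blast
  have chamber: "in_chamber w I" if I: "I \<in> F" "\<forall>i\<in>I. 0 < f \<bullet> r I i" for I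
    unfolding in_chamber_def
  proof (intro conjI ballI)
    fix i assume i: "i \<in> I"
    then have "r I i \<in> W w ` \<Phi>"
      using I root_function_in_roots[of i I] word_act_image_roots[OF w(1)] by (auto simp: facets_iff)
    then obtain b where b: "b \<in> \<Phi>" "r I i = W w b" by blast
    then have "b \<notin> \<Phi>p" using w(2) I i by (metis less_asym')
    then have "- b \<in> \<Phi>p" using root_positive_or_negative b by blast
    then show "\<exists>b\<in>\<Phi>p. r I i = - W w b" using b by (intro bexI[of _ "- b"]) simp_all
  qed (use I in simp)
  obtain I where I: "I \<in> F" "\<forall>i\<in>I. 0 < f \<bullet> r I i"
    using exists_improving_facet[OF f initial_facet] by blast
  \<comment> \<open>The facet reached from \<open>J\<close> by improving flips lies in the same
    chamber as \<open>I\<close>, so it is \<open>I\<close>.\<close>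
  have "\<forall>k\<in>{1..n + N}. f \<bullet> wt J k \<le> f \<bullet> wt I k" if "J \<in> F" for J
    using exists_improving_facet[OF f that] in_chamber_unique[OF w(1)] chamber I by metis
  then show ?thesis using I by blast
qed

section \<open>Minkowski sums of weight polytopes\<close>

lemma exists_generic_separation:
  assumes "finite B" "\<And>b. b \<in> B \<Longrightarrow> a \<bullet> b < a \<bullet> x"
  shows "\<exists>f. generic f \<and> (\<forall>b\<in>B. f \<bullet> b < f \<bullet> x)"
proof -
  obtain h where h: "\<forall>b\<in>\<Phi>p. 0 < h \<bullet> b" using exists_dominant by blast
  \<comment> \<open>Finitely many strict inequalities survive a small perturbation. The direction
    \<open>h\<close> is orthogonal to no root, so it also repairs the roots on which
    \<open>a\<close> vanishes.\<close>
  have lim: "((\<lambda>e::real. (a + e *\<^sub>R h) \<bullet> v) \<longlongrightarrow> a \<bullet> v) (at_right 0)" for v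
    by (auto intro!: tendsto_eq_intros)
  have "eventually (\<lambda>e. (a + e *\<^sub>R h) \<bullet> b < (a + e *\<^sub>R h) \<bullet> x) (at_right 0)" if "b \<in> B" for b
  proof -
    have "eventually (\<lambda>e. 0 < (a + e *\<^sub>R h) \<bullet> (x - b)) (at_right 0)"
      using order_tendstoD(1)[OF lim[of "x - b"], of 0] assms(2)[OF that]
      by (simp add: inner_diff_right)
    then show ?thesis by (simp add: inner_diff_right)
  qed
  then have 1: "eventually (\<lambda>e. \<forall>b\<in>B. (a + e *\<^sub>R h) \<bullet> b < (a + e *\<^sub>R h) \<bullet> x) (at_right 0)"
    using assms(1) by (intro eventually_ball_finite) auto
  have "eventually (\<lambda>e. (a + e *\<^sub>R h) \<bullet> b \<noteq> 0) (at_right 0)" if "b \<in> \<Phi>" for b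
  proof (cases "a \<bullet> b = 0")
    case True
    have "h \<bullet> b \<noteq> 0" using root_positive_or_negative[OF that] h by force
    then show ?thesis
      using True eventually_at_right_less[of "0::real"]
      by (auto simp: inner_add_left elim: eventually_mono)
  next
    case False
    then show ?thesis using lim tendsto_imp_eventually_ne by blast
  qed
  then have 2: "eventually (\<lambda>e. \<forall>b\<in>\<Phi>. (a + e *\<^sub>R h) \<bullet> b \<noteq> 0) (at_right 0)"
    using finite_roots by (intro eventually_ball_finite) auto
  show ?thesis
    using eventually_happens[OF eventually_conj[OF 1 2]] by (auto simp: generic_def)
qed

text \<open>The point is that a mixed sum, choosing a different facet for each \<open>k\<close>,
  stays in the hull. A functional separating it would be bounded on every summand by one and the
  same facet.\<close>

lemma convex_hull_sum_weights:
  assumes K: "K \<subseteq> {1..n + N}"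
  shows "convex hull ((\<lambda>I. \<Sum>k\<in>K. wt I k) ` F) = (\<Sum>k\<in>K. convex hull ((\<lambda>I. wt I k) ` F))"
    (is "convex hull ?B = _")
proof -
  have fin: "finite K" using K finite_subset by blast
  have "(\<Sum>k\<in>K. (\<lambda>I. wt I k) ` F) \<subseteq> convex hull ?B"
  proof
    fix x assume "x \<in> (\<Sum>k\<in>K. (\<lambda>I. wt I k) ` F)"
    then obtain s where s: "x = sum s K" "\<forall>k\<in>K. s k \<in> (\<lambda>I. wt I k) ` F"
      unfolding set_sum_alt[OF fin] by blast
    show "x \<in> convex hull ?B"
    proof (rule ccontr)
      assume "x \<notin> convex hull ?B"
      moreover have "closed (convex hull ?B)"
        using finite_facets by (intro compact_imp_closed finite_imp_compact_convex_hull) simp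
      ultimately obtain a c where "a \<bullet> x < c" "\<forall>y\<in>convex hull ?B. c < a \<bullet> y"
        using separating_hyperplane_closed_point[OF convex_convex_hull] by metis
      \<comment> \<open>The sign is changed so that \<open>x\<close> beats the hull from above,
        matching the maximizing facet.\<close>
      then have "(- a) \<bullet> b < (- a) \<bullet> x" if "b \<in> ?B" for b
        using hull_inc[OF that, of convex] by (smt (verit) inner_minus_left)
      then obtain f where f: "generic f" "\<forall>b\<in>?B. f \<bullet> b < f \<bullet> x"
        using exists_generic_separation[of ?B "- a" x] finite_facets by blast
      obtain I where I: "I \<in> F" "\<forall>J\<in>F. \<forall>k\<in>{1..n + N}. f \<bullet> wt J k \<le> f \<bullet> wt I k"
        using exists_dominating_facet[OF f(1)] by blast
      have "f \<bullet> x \<le> f \<bullet> (\<Sum>k\<in>K. wt I k)"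
        unfolding s(1) inner_sum_right using s(2) I K by (intro sum_mono) fastforce
      then show False using f(2) I(1) by fastforce
    qed
  qed
  then have "convex hull (\<Sum>k\<in>K. (\<lambda>I. wt I k) ` F) \<subseteq> convex hull ?B"
    by (simp add: hull_minimal)
  moreover have "?B \<subseteq> (\<Sum>k\<in>K. (\<lambda>I. wt I k) ` F)"
    unfolding set_sum_alt[OF fin] by blast
  then have "convex hull ?B \<subseteq> convex hull (\<Sum>k\<in>K. (\<lambda>I. wt I k) ` F)"
    by (rule hull_mono)
  ultimately show ?thesis by (simp add: convex_hull_set_sum)
qed

text \<open>The letters before position \<open>k\<close> are reflections in other simple roots,
  which fix \<open>\<omega> k\<close>.\<close>

lemma weight_function_initial:
  assumes "k \<in> {1..n}"
  shows "wt I k = \<omega> k"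
proof -
  have "pp I l (\<omega> k) = \<omega> k" if "1 \<le> l" "l \<le> k" for l
    using that
  proof (induction l rule: nat_induct_at_least)
    case (Suc l)
    then have "reflection (\<alpha> (Q l)) (\<omega> k) = \<omega> k"
      using assms by (intro reflection_weight) (auto simp: Q_letter_initial)
    then show ?case using Suc by (simp add: pp_Suc)
  qed simp
  then show ?thesis using assms by (simp add: weight_function_def Q_letter_initial)
qed

lemma bij_betw_greedy_roots: "bij_betw (r {1..n}) {n + 1..n + N} \<Phi>p"
proof -
  have "{1..n + N} - {1..n} = {n + 1..n + N}" by auto
  then show ?thesis using bij_betw_root_function[OF initial_facet] by simp
qed

lemma root_position_root_function:
  assumes "k \<in> {n + 1..n + N}"
  shows "root_position \<alpha> n (r {1..n} k) = k"
  unfolding root_position_def greedy_facet_eq length_Q_word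
  using assms bij_betw_imp_inj_on[OF bij_betw_greedy_roots]
  by (intro the_equality) (auto dest: inj_onD)

lemma sum_root_position:
  "(\<Sum>b\<in>\<Phi>p. g (root_position \<alpha> n b)) = (\<Sum>k=n + 1..n + N. g k)"
  by (subst sum.reindex_bij_betw[OF bij_betw_greedy_roots, symmetric])
    (intro sum.cong refl arg_cong[of _ _ g] root_position_root_function)

lemma brick_polytope_eq:
  "brick_polytope \<alpha> n =
    (+) (\<Sum>k=1..n. \<omega> k) ` (\<Sum>k=n + 1..n + N. convex hull ((\<lambda>I. wt I k) ` F))"
proof -
  have "brick_vector \<alpha> n I = (\<Sum>k=1..n. \<omega> k) + (\<Sum>k=n + 1..n + N. wt I k)" for I
    unfolding brick_vector_def length_Q_word
    by (subst sum.ub_add_nat) (auto simp: weight_function_initial)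
  then have "brick_vector \<alpha> n ` F =
      (+) (\<Sum>k=1..n. \<omega> k) ` (\<lambda>I. \<Sum>k=n + 1..n + N. wt I k) ` F"
    by (simp add: image_image)
  then show ?thesis
    unfolding brick_polytope_def
    using convex_hull_sum_weights[of "{n + 1..n + N}"] by (simp add: convex_hull_translation)
qed

end

section \<open>Homogeneous elements\<close>

locale exponent_grading =
  fixes D :: "(nat \<Rightarrow>\<^sub>0 int) \<Rightarrow> int"
  assumes D_add: "D (a + b) = D a + D b"
begin

lemma D_0 [simp]: "D 0 = 0"
  using D_add[of 0 0] by simp

definition homogeneous :: "int \<Rightarrow> laurent \<Rightarrow> bool" where
  "homogeneous d p \<longleftrightarrow> (\<forall>e\<in>Poly_Mapping.keys p. D e = d)"

lemma homogeneous_0 [simp]: "homogeneous d 0"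
  by (simp add: homogeneous_def)

lemma homogeneous_1: "homogeneous 0 1"
  by (simp add: homogeneous_def)

lemma homogeneous_add: "homogeneous d p \<Longrightarrow> homogeneous d q \<Longrightarrow> homogeneous d (p + q)"
  using Poly_Mapping.keys_add[of p q] by (auto simp: homogeneous_def)

lemma homogeneous_mult: "homogeneous d p \<Longrightarrow> homogeneous d' q \<Longrightarrow> homogeneous (d + d') (p * q)"
  using keys_mult[of p q] by (fastforce simp: homogeneous_def D_add)

text \<open>The part of \<open>L\<close> in any other degree would contribute a nonzero part of a wrong degree
  to \<open>L * b\<close>.\<close>
lemma homogeneous_factor:
  assumes b: "homogeneous d b" "b \<noteq> 0" and Lb: "homogeneous (c + d) (L * b)"
  shows "homogeneous c L"
  unfolding homogeneous_def
proof (rule ballI, rule ccontr)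
  fix e assume e: "e \<in> Poly_Mapping.keys L" and ne: "D e \<noteq> c"
  \<comment> \<open>\<open>L1\<close> is the component of the wrong degree \<open>D e\<close> and
    \<open>L2\<close> the rest, so their products with \<open>b\<close> share no monomial.\<close>
  define L1 where "L1 = Poly_Mapping.mapp (\<lambda>e' v. v when D e' = D e) L"
  define L2 where "L2 = Poly_Mapping.mapp (\<lambda>e' v. v when D e' \<noteq> D e) L"
  have L: "L = L1 + L2"
    by (rule poly_mapping_eqI)
      (auto simp: L1_def L2_def lookup_add lookup_mapp when_def in_keys_iff)
  have L1: "homogeneous (D e) L1"
    using keys_mapp_subset[of _ L] by (auto simp: homogeneous_def L1_def lookup_mapp in_keys_iff)
  have L2: "D e' \<noteq> D e" if "e' \<in> Poly_Mapping.keys L2" for e'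
    using that by (auto simp: L2_def lookup_mapp in_keys_iff)
  have "Poly_Mapping.lookup (L1 * b) x = 0" for x
  proof (rule ccontr)
    assume "Poly_Mapping.lookup (L1 * b) x \<noteq> 0"
    then have x: "D x = D e + d"
      using homogeneous_mult[OF L1 b(1)] by (auto simp: homogeneous_def in_keys_iff)
    have "x \<notin> Poly_Mapping.keys (L2 * b)"
    proof
      assume "x \<in> Poly_Mapping.keys (L2 * b)"
      then obtain y z where "x = y + z" "y \<in> Poly_Mapping.keys L2" "z \<in> Poly_Mapping.keys b"
        using keys_mult[of L2 b] by blast
      then show False using L2 b(1) x by (auto simp: homogeneous_def D_add)
    qed
    moreover have "x \<notin> Poly_Mapping.keys (L * b)"
      using Lb x ne by (auto simp: homogeneous_def)
    ultimately have "Poly_Mapping.lookup (L1 * b) x = 0"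
      by (simp add: L distrib_right in_keys_iff lookup_add)
    then show False using \<open>Poly_Mapping.lookup (L1 * b) x \<noteq> 0\<close> by simp
  qed
  then have "L1 * b = 0" by (intro poly_mapping_eqI) simp
  then have "L1 = 0" using b(2) by simp
  then have "Poly_Mapping.lookup L1 e = 0" by simp
  then show False using e by (simp add: L1_def lookup_mapp in_keys_iff)
qed

text \<open>The degree is that of the numerator minus that of the denominator, for some
  representation. Zero has every degree, which fits division by zero.\<close>

definition fract_homogeneous :: "int \<Rightarrow> laurent fract \<Rightarrow> bool" where
  "fract_homogeneous d u \<longleftrightarrow>
     (\<exists>a b c. b \<noteq> 0 \<and> u = Fract a b \<and> homogeneous (d + c) a \<and> homogeneous c b)"

lemma fract_homogeneousI:
  "b \<noteq> 0 \<Longrightarrow> homogeneous (d + c) a \<Longrightarrow> homogeneous c b \<Longrightarrow> fract_homogeneous d (Fract a b)"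
  unfolding fract_homogeneous_def by blast

lemma rat_fun_homogeneous: "homogeneous d L \<Longrightarrow> fract_homogeneous d (rat_fun L)"
  unfolding rat_fun_def using homogeneous_1 by (intro fract_homogeneousI[where c = 0]) auto

lemma fract_homogeneous_1: "fract_homogeneous 0 1"
  using rat_fun_homogeneous[OF homogeneous_1] by (simp add: rat_fun_def One_fract_def)

lemma fract_homogeneous_0: "fract_homogeneous d 0"
  using rat_fun_homogeneous[OF homogeneous_0] by (simp add: rat_fun_def Zero_fract_def)

lemma fract_homogeneous_mult:
  assumes "fract_homogeneous d u" "fract_homogeneous d' v"
  shows "fract_homogeneous (d + d') (u * v)"
proof -
  obtain a b c where u: "b \<noteq> 0" "u = Fract a b" "homogeneous (d + c) a" "homogeneous c b"
    using assms unfolding fract_homogeneous_def by blast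
  obtain a' b' c' where v: "b' \<noteq> 0" "v = Fract a' b'" "homogeneous (d' + c') a'" "homogeneous c' b'"
    using assms unfolding fract_homogeneous_def by blast
  have "fract_homogeneous (d + d') (Fract (a * a') (b * b'))"
    using u v homogeneous_mult[of "d + c" a "d' + c'" a'] homogeneous_mult[of c b c' b']
    by (intro fract_homogeneousI[where c = "c + c'"]) (simp_all add: ac_simps)
  then show ?thesis by (simp add: u v)
qed

lemma fract_homogeneous_add:
  assumes "fract_homogeneous d u" "fract_homogeneous d v"
  shows "fract_homogeneous d (u + v)"
proof -
  obtain a b c where u: "b \<noteq> 0" "u = Fract a b" "homogeneous (d + c) a" "homogeneous c b"
    using assms unfolding fract_homogeneous_def by blast
  obtain a' b' c' where v: "b' \<noteq> 0" "v = Fract a' b'" "homogeneous (d + c') a'" "homogeneous c' b'"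
    using assms unfolding fract_homogeneous_def by blast
  have "homogeneous (d + (c + c')) (a * b')" "homogeneous (d + (c + c')) (a' * b)"
    using u v homogeneous_mult[of "d + c" a c' b'] homogeneous_mult[of "d + c'" a' c b]
    by (simp_all add: ac_simps)
  then have "fract_homogeneous d (Fract (a * b' + a' * b) (b * b'))"
    using u v homogeneous_mult[of c b c' b']
    by (intro fract_homogeneousI[where c = "c + c'"] homogeneous_add) simp_all
  then show ?thesis by (simp add: u v)
qed

lemma fract_homogeneous_divide:
  assumes "fract_homogeneous d u" "fract_homogeneous d' v"
  shows "fract_homogeneous (d - d') (u / v)"
proof (cases "v = 0")
  case True
  then show ?thesis by (simp add: fract_homogeneous_0)
next
  case False
  obtain a b c where u: "b \<noteq> 0" "u = Fract a b" "homogeneous (d + c) a" "homogeneous c b"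
    using assms unfolding fract_homogeneous_def by blast
  obtain a' b' c' where v: "b' \<noteq> 0" "v = Fract a' b'" "homogeneous (d' + c') a'" "homogeneous c' b'"
    using assms unfolding fract_homogeneous_def by blast
  have "a' \<noteq> 0" using False v by (auto simp: fract_collapse)
  then have "fract_homogeneous (d - d') (Fract (a * b') (b * a'))"
    using u v homogeneous_mult[of "d + c" a c' b'] homogeneous_mult[of c b "d' + c'" a']
    by (intro fract_homogeneousI[where c = "c + (d' + c')"]) (simp_all add: algebra_simps)
  then show ?thesis by (simp add: u v)
qed

lemma fract_homogeneous_power:
  "fract_homogeneous d u \<Longrightarrow> fract_homogeneous (int k * d) (u ^ k)"
proof (induction k)
  case (Suc k)
  then show ?case
    using fract_homogeneous_mult[of d u "int k * d" "u ^ k"] by (simp add: algebra_simps)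
qed (simp add: fract_homogeneous_1)

lemma fract_homogeneous_prod:
  assumes "\<And>i. i \<in> A \<Longrightarrow> fract_homogeneous (d i) (f i)"
  shows "fract_homogeneous (\<Sum>i\<in>A. d i) (\<Prod>i\<in>A. f i)"
  using assms
  by (induction A rule: infinite_finite_induct) (auto simp: fract_homogeneous_1 fract_homogeneous_mult)

lemma homogeneous_if_rat_fun:
  assumes "fract_homogeneous d (rat_fun L)"
  shows "homogeneous d L"
proof -
  obtain a b c where b: "b \<noteq> 0" "rat_fun L = Fract a b" "homogeneous (d + c) a" "homogeneous c b"
    using assms unfolding fract_homogeneous_def by blast
  then have "L * b = a" by (simp add: rat_fun_def eq_fract)
  then show ?thesis using b homogeneous_factor by blast
qed

end

section \<open>Mutation\<close>

text \<open>This invariant keeps the diagonal zero: mutation could change \<open>B i i\<close> if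
  \<open>B i k\<close> and \<open>B k i\<close> had the same sign.\<close>

definition skew_symmetrized :: "(nat \<Rightarrow> real) \<Rightarrow> nat \<Rightarrow> (nat \<Rightarrow> nat \<Rightarrow> int) \<Rightarrow> bool" where
  "skew_symmetrized t n B \<longleftrightarrow> (\<forall>i\<in>{1..n}. 0 < t i) \<and>
     (\<forall>i\<in>{1..n}. \<forall>j\<in>{1..n}. t i * B i j = - (t j * B j i))"

lemma skew_symmetrized_mutate:
  assumes B: "skew_symmetrized t n B" and k: "k \<in> {1..n}"
  shows "skew_symmetrized t n (mutate_matrix k B)"
proof -
  have pos: "0 < t i" if "i \<in> {1..n}" for i
    using B that by (simp add: skew_symmetrized_def)
  have skew: "t i * B i j = - (t j * B j i)" if "i \<in> {1..n}" "j \<in> {1..n}" for i j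
    using B that unfolding skew_symmetrized_def by blast
  have "t i * mutate_matrix k B i j = - (t j * mutate_matrix k B j i)"
    if i: "i \<in> {1..n}" and j: "j \<in> {1..n}" for i j
  proof (cases "i = k \<or> j = k")
    case True
    then show ?thesis using skew[OF i j] by (auto simp: mutate_matrix_def)
  next
    case False
    have ik: "t i * B i k = - (t k * B k i)" and jk: "t j * B j k = - (t k * B k j)"
      using skew i j k by blast+
    have sgn_ki: "sgn (B k i) = - sgn (B i k)" and sgn_jk: "sgn (B j k) = - sgn (B k j)"
    proof -
      have "sgn (t i * B i k) = - sgn (t k * B k i)" "sgn (t j * B j k) = - sgn (t k * B k j)"
        unfolding ik jk sgn_minus by simp_all
      then have "sgn (real_of_int (B i k)) = - sgn (real_of_int (B k i))"
        "sgn (real_of_int (B j k)) = - sgn (real_of_int (B k j))"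
        using pos[OF i] pos[OF j] pos[OF k] by (simp_all add: sgn_mult)
      then show "sgn (B k i) = - sgn (B i k)" "sgn (B j k) = - sgn (B k j)"
        by (auto simp: sgn_if split: if_splits)
    qed
    \<comment> \<open>Both sides equal \<open>- t k * B k i * B k j\<close>, which is symmetric in
      \<open>i\<close> and \<open>j\<close>; the required sign comes from the \<open>sgn\<close>
      factors.\<close>
    have prod: "t i * (B i k * B k j) = t j * (B j k * B k i)"
    proof -
      have "t i * (B i k * B k j) = - (t k * B k i) * B k j"
        unfolding ik[symmetric] by simp
      also have "\<dots> = - (t k * B k j) * B k i" by simp
      also have "\<dots> = t j * (B j k * B k i)"
        unfolding jk[symmetric] by simp
      finally show ?thesis .
    qed
    have "t i * (sgn (B i k) * max 0 (B i k * B k j)) = - (t j * (sgn (B j k) * max 0 (B j k * B k i)))"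
    proof (cases "0 < B i k * B k j")
      case True
      have "0 < t j * (B j k * B k i)"
        using prod True pos[OF i] by (metis mult_pos_pos of_int_0_less_iff)
      then have pos': "0 < B j k * B k i"
        using pos[OF j] by (metis of_int_0_less_iff zero_less_mult_pos)
      have "sgn (B i k) = - sgn (B j k)"
        using True sgn_jk by (auto simp: zero_less_mult_iff)
      then show ?thesis
        using True pos' prod by (simp add: max_def algebra_simps)
    next
      case False
      then have "B i k * B k j \<le> 0" by simp
      then have "t i * (B i k * B k j) \<le> 0"
        using pos[OF i] by (metis less_imp_le mult_nonneg_nonpos of_int_le_0_iff)
      then have "real_of_int (B j k * B k i) \<le> 0"
        unfolding prod using pos[OF j] by (metis linorder_not_le mult_pos_pos)
      then have "B j k * B k i \<le> 0" by linarith
      then show ?thesis using False by (simp add: max_def)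
    qed
    then show ?thesis
      using False skew[OF i j] by (simp add: mutate_matrix_def algebra_simps)
  qed
  then show ?thesis using pos unfolding skew_symmetrized_def by blast
qed

lemma skew_symmetrized_diagonal:
  assumes "skew_symmetrized t n B" "k \<in> {1..n}"
  shows "B k k = 0"
proof -
  have "0 < t k" "t k * B k k = - (t k * B k k)"
    using assms unfolding skew_symmetrized_def by blast+
  then show ?thesis by simp
qed

text \<open>Homogeneity of the exchange relations is the vanishing of the degrees of the products
  \<open>\<Prod>\<^sub>i z\<^sub>i ^ b\<^sub>i\<^sub>k\<close>.\<close>
definition balanced :: "nat \<Rightarrow> (nat \<Rightarrow> nat \<Rightarrow> int) \<Rightarrow> (nat \<Rightarrow> int) \<Rightarrow> bool" where
  "balanced n B d \<longleftrightarrow> (\<forall>k\<in>{1..n}. (\<Sum>i=1..2 * n. B i k * d i) = 0)"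

text \<open>The degree at \<open>k\<close> is updated as the exchange relation dictates, and the new
  column sums are combinations of old ones.\<close>

lemma balanced_mutate:
  assumes bal: "balanced n B d" and k: "k \<in> {1..n}" and Bkk: "B k k = 0"
  shows "balanced n (mutate_matrix k B) (d(k := (\<Sum>i=1..2 * n. int (nat (B i k)) * d i) - d k))"
    (is "balanced n ?B ?d")
  unfolding balanced_def
proof
  fix j assume j: "j \<in> {1..n}"
  have sum_k: "(\<Sum>i=1..2 * n. B i k * d i) = 0" and sum_j: "(\<Sum>i=1..2 * n. B i j * d i) = 0"
    using bal j k by (auto simp: balanced_def)
  have k2: "k \<in> {1..2 * n}" using k by auto
  let ?S = "\<Sum>i=1..2 * n. int (nat (B i k)) * d i"
  show "(\<Sum>i=1..2 * n. ?B i j * ?d i) = 0"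
  proof (cases "j = k")
    case True
    then have "?B i j * ?d i = - (B i k * d i)" for i
      using Bkk by (simp add: mutate_matrix_def)
    then show ?thesis using sum_k by (simp add: sum_negf)
  next
    case False
    \<comment> \<open>With this factor, the negative part of \<open>B k j\<close>, the changes to
      column \<open>j\<close> add up to \<open>c\<close> times the old sum of column
      \<open>k\<close>.\<close>
    define c where "c = (if 0 \<le> B k j then 0 else - B k j)"
    \<comment> \<open>For \<open>i = k\<close> both the sign of the entry and the degree change; the
      product is the old term minus \<open>B k j * ?S\<close>, and the middle term vanishes as
      \<open>B k k = 0\<close>.\<close>
    have "?B i j * ?d i =
      B i j * d i + sgn (B i k) * max 0 (B i k * B k j) * d i + (if i = k then - B k j * ?S else 0)" for i
      using False Bkk by (simp add: mutate_matrix_def algebra_simps)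
    then have "(\<Sum>i=1..2 * n. ?B i j * ?d i) =
      (\<Sum>i=1..2 * n. sgn (B i k) * max 0 (B i k * B k j) * d i) - B k j * ?S"
      using k2 sum_j by (simp add: sum.distrib)
    also have "\<dots> = (\<Sum>i=1..2 * n. (sgn (B i k) * max 0 (B i k * B k j) - B k j * int (nat (B i k))) * d i)"
      by (simp add: sum_distrib_left sum_subtractf algebra_simps)
    also have "\<dots> = (\<Sum>i=1..2 * n. c * (B i k * d i))"
    proof (rule sum.cong[OF refl])
      fix i
      have "sgn (B i k) * max 0 (B i k * B k j) - B k j * int (nat (B i k)) = c * B i k"
        by (cases "0 \<le> B k j"; cases "0 < B i k")
          (auto simp: c_def max_def sgn_if mult_le_0_iff zero_le_mult_iff)
      then show "(sgn (B i k) * max 0 (B i k * B k j) - B k j * int (nat (B i k))) * d i =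
          c * (B i k * d i)"
        by (simp add: algebra_simps)
    qed
    also have "\<dots> = 0" using sum_k by (simp flip: sum_distrib_left)
    finally show ?thesis .
  qed
qed

text \<open>Balance says exactly that the two monomials of an exchange relation have equal degree,
  so their sum is homogeneous.\<close>

lemma (in exponent_grading) seed_homogeneous:
  assumes "seed \<alpha> n B z"
    and initial: "skew_symmetrized t n (initial_matrix \<alpha> n)"
      "balanced n (initial_matrix \<alpha> n) (\<lambda>i. D (Poly_Mapping.single i 1))"
  shows "skew_symmetrized t n B \<and>
    (\<exists>d. balanced n B d \<and> (\<forall>i\<in>{1..2 * n}. fract_homogeneous (d i) (z i)))"
  using assms(1)
proof induction
  case initial
  have "fract_homogeneous (D (Poly_Mapping.single i 1)) (rat_fun (laurent_var i))" for i
    by (intro rat_fun_homogeneous) (simp add: homogeneous_def laurent_var_def)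
  then show ?case using assms(2,3) by blast
next
  case (mutate B z k)
  then obtain d where d: "balanced n B d"
    and z: "\<And>i. i \<in> {1..2 * n} \<Longrightarrow> fract_homogeneous (d i) (z i)"
    and skew: "skew_symmetrized t n B" by blast
  let ?S = "\<Sum>i=1..2 * n. int (nat (B i k)) * d i"
  have k2: "k \<in> {1..2 * n}" using mutate by auto
  have "?S - (\<Sum>i=1..2 * n. int (nat (- B i k)) * d i) = (\<Sum>i=1..2 * n. B i k * d i)"
    unfolding sum_subtractf[symmetric]
  proof (rule sum.cong[OF refl])
    fix i
    have "int (nat (B i k)) - int (nat (- B i k)) = B i k" by simp
    then show "int (nat (B i k)) * d i - int (nat (- B i k)) * d i = B i k * d i"
      by (metis left_diff_distrib)
  qed
  then have eq: "(\<Sum>i=1..2 * n. int (nat (- B i k)) * d i) = ?S"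
    using d mutate by (simp add: balanced_def)
  have prod: "fract_homogeneous (\<Sum>i=1..2 * n. int (m i) * d i) (\<Prod>i=1..2 * n. z i ^ m i)" for m
    by (intro fract_homogeneous_prod fract_homogeneous_power z)
  have "fract_homogeneous ?S (\<Prod>i=1..2 * n. z i ^ nat (B i k))"
    "fract_homogeneous ?S (\<Prod>i=1..2 * n. z i ^ nat (- B i k))"
    using prod[of "\<lambda>i. nat (B i k)"] prod[of "\<lambda>i. nat (- B i k)"] unfolding eq .
  then have "fract_homogeneous (?S - d k)
      (((\<Prod>i=1..2 * n. z i ^ nat (B i k)) + (\<Prod>i=1..2 * n. z i ^ nat (- B i k))) / z k)"
    using fract_homogeneous_divide[OF fract_homogeneous_add z[OF k2]] by blast
  then have "\<forall>i\<in>{1..2 * n}. fract_homogeneous ((d(k := ?S - d k)) i) (mutate_cluster n k B z i)"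
    using z by (simp add: mutate_cluster_def)
  then show ?case
    using balanced_mutate[OF d mutate(2) skew_symmetrized_diagonal[OF skew mutate(2)]]
      skew_symmetrized_mutate[OF skew mutate(2)] by blast
qed

lemma (in exponent_grading) cluster_variable_homogeneous:
  assumes "rat_fun L \<in> cluster_variables \<alpha> n"
    and "skew_symmetrized t n (initial_matrix \<alpha> n)"
      "balanced n (initial_matrix \<alpha> n) (\<lambda>i. D (Poly_Mapping.single i 1))"
  shows "\<exists>d. \<forall>e\<in>Poly_Mapping.keys L. D e = d"
proof -
  obtain B z i where seed: "seed \<alpha> n B z" and i: "i \<in> {1..n}" "rat_fun L = z i"
    using assms(1) unfolding cluster_variables_def by blast
  obtain d where "\<forall>i\<in>{1..2 * n}. fract_homogeneous (d i) (z i)"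
    using seed_homogeneous[OF seed assms(2,3)] by blast
  moreover have "i \<in> {1..2 * n}" using i by auto
  ultimately have "homogeneous (d i) L"
    using i homogeneous_if_rat_fun by metis
  then show ?thesis unfolding homogeneous_def by blast
qed

section \<open>Laurent expansions and Newton polytopes\<close>

lemma rat_fun_inject: "rat_fun a = rat_fun b \<longleftrightarrow> a = b"
  by (simp add: rat_fun_def eq_fract)

lemma rat_fun_mult: "rat_fun (a * b) = rat_fun a * rat_fun b"
  by (simp add: rat_fun_def)

text \<open>The d-vector presents \<open>u\<close> as a polynomial over a monomial, and monomials
  are units among Laurent polynomials.\<close>

lemma rat_fun_laurent_expansion:
  assumes "has_d_vector \<alpha> n u v"
  shows "rat_fun (laurent_expansion u) = u"
proof -
  define X where "X e = rat_fun (Poly_Mapping.single e 1)" for e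
  have X_add: "X (a + b) = X a * X b" for a b
    by (simp add: X_def mult_single flip: rat_fun_mult)
  have X_0: "X 0 = 1"
    by (simp add: X_def rat_fun_def One_fract_def)
  have X_inverse: "inverse (X a) = X (- a)" for a
    using X_add[of a "- a"] X_0 by (intro inverse_unique) simp
  have X_power: "X (Poly_Mapping.single i a) ^ k = X (Poly_Mapping.single i (int k * a))" for i a k
    by (induction k) (simp_all add: X_0 distrib_right flip: X_add single_add)
  have X_powi: "X (Poly_Mapping.single i 1) powi d = X (Poly_Mapping.single i d)" for i d
    by (cases "0 \<le> d")
      (simp_all add: power_int_def X_power X_inverse power_inverse flip: single_uminus)
  have X_prod: "(\<Prod>i\<in>A. X (f i)) = X (\<Sum>i\<in>A. f i)" for A :: "nat set" and f
    by (induction A rule: infinite_finite_induct) (auto simp: X_0 X_add)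
  obtain p d where "u = rat_fun p / (\<Prod>i = 1..n. rat_fun (laurent_var i) powi d i)"
    using assms unfolding has_d_vector_def by blast
  then have "u = rat_fun p * X (- (\<Sum>i=1..n. Poly_Mapping.single i (d i)))"
    by (simp add: laurent_var_def X_powi X_prod divide_inverse X_inverse flip: X_def)
  then have u: "u = rat_fun (p * Poly_Mapping.single (- (\<Sum>i=1..n. Poly_Mapping.single i (d i))) 1)"
    by (simp add: X_def rat_fun_mult)
  then have "laurent_expansion u = p * Poly_Mapping.single (- (\<Sum>i=1..n. Poly_Mapping.single i (d i))) 1"
    unfolding laurent_expansion_def by (simp add: rat_fun_inject)
  then show ?thesis using u by simp
qed

lemma keys_sum_single:
  assumes "finite S" "inj_on f S" "\<And>e. e \<in> S \<Longrightarrow> c e \<noteq> 0"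
  shows "Poly_Mapping.keys (\<Sum>e\<in>S. Poly_Mapping.single (f e) (c e)) = f ` S"
proof -
  have lookup: "Poly_Mapping.lookup (\<Sum>e\<in>S. Poly_Mapping.single (f e) (c e)) x = (\<Sum>e\<in>S. c e when f e = x)" for x
    by (simp add: lookup_sum lookup_single)
  have "(\<Sum>e\<in>S. c e when f e = f a) = c a" if "a \<in> S" for a
  proof -
    have "(\<Sum>e\<in>S. c e when f e = f a) = (\<Sum>e\<in>S. if e = a then c e else 0)"
      using assms(2) that by (intro sum.cong) (auto simp: when_def dest: inj_onD)
    then show ?thesis using assms(1) that by simp
  qed
  moreover have "(\<Sum>e\<in>S. c e when f e = x) = 0" if "x \<notin> f ` S" for x
    using that by (intro sum.neutral) (auto simp: when_def)
  ultimately have "(\<Sum>e\<in>S. c e when f e = x) \<noteq> 0 \<longleftrightarrow> x \<in> f ` S" for x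
    using assms(3) by (cases "x \<in> f ` S") auto
  then show ?thesis
    by (auto simp: in_keys_iff lookup)
qed

text \<open>Injectivity ensures that distinct monomials stay distinct under the substitution, so no
  coefficients cancel.\<close>

lemma newton_F_eq:
  assumes inj: "inj_on (\<lambda>e. \<Sum>i = 1..n. Poly_Mapping.single (n + i) (Poly_Mapping.lookup e (n + i)))
      (Poly_Mapping.keys (laurent_expansion u))"
  shows "newton_F \<alpha> n u = convex hull (y_exponent \<alpha> n ` Poly_Mapping.keys (laurent_expansion u))"
proof -
  let ?f = "\<lambda>e. \<Sum>i = 1..n. Poly_Mapping.single (n + i) (Poly_Mapping.lookup e (n + i))"
  have lookup: "Poly_Mapping.lookup (?f e) (n + j) = Poly_Mapping.lookup e (n + j)"
    if "j \<in> {1..n}" for e :: "nat \<Rightarrow>\<^sub>0 int" and j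
    using that by (simp add: lookup_sum lookup_single when_def)
  have "Poly_Mapping.keys (F_polynomial n u) = ?f ` Poly_Mapping.keys (laurent_expansion u)"
    unfolding F_polynomial_def set_x_one_def using inj by (intro keys_sum_single) (auto simp: in_keys_iff)
  moreover have "y_exponent \<alpha> n (?f e) = y_exponent \<alpha> n e" for e
    unfolding y_exponent_def by (intro sum.cong) (simp_all add: lookup del: One_nat_def)
  ultimately show ?thesis
    by (simp add: newton_F_def image_image)
qed

lemma sum_frozen: "(\<Sum>i=1..2 * n. g i) = (\<Sum>i=1..n. g i) + (\<Sum>i=1..n. g (n + i))"
  for g :: "nat \<Rightarrow> 'b::comm_monoid_add"
proof -
  have "(\<Sum>i=1..2 * n. g i) = (\<Sum>i=1..n. g i) + (\<Sum>i=n + 1..n + n. g i)"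
    by (subst mult_2, rule sum.ub_add_nat) simp
  also have "(\<Sum>i=n + 1..n + n. g i) = (\<Sum>i=1..n. g (i + n))"
    using sum.shift_bounds_cl_nat_ivl[of g 1 n n] by (simp add: add.commute)
  finally show ?thesis by (simp add: add.commute)
qed

section \<open>Exponents of cluster variables\<close>

context root_basis
begin

abbreviation "B0 \<equiv> initial_matrix \<alpha> n"

lemma cartan_eq:
  assumes "i \<in> {1..n}" "j \<in> {1..n}"
  shows "(\<alpha> i \<bullet> \<alpha> i) * cartan \<alpha> i j = 2 * (\<alpha> i \<bullet> \<alpha> j)"
proof -
  have "2 * (\<alpha> i \<bullet> \<alpha> j) / (\<alpha> i \<bullet> \<alpha> i) \<in> \<int>"
    using root_system assms simple_root_in_roots by (auto simp: crystallographic_root_system_def)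
  then have "real_of_int (cartan \<alpha> i j) = 2 * (\<alpha> i \<bullet> \<alpha> j) / (\<alpha> i \<bullet> \<alpha> i)"
    unfolding cartan_def by (metis Ints_cases floor_of_int)
  then show ?thesis
    using simple_root_nonzero[OF assms(1)] by simp
qed

text \<open>Squared root lengths symmetrize the Cartan matrix, and the signs of \<open>B0\<close>
  depend on the order of the indices.\<close>

lemma skew_symmetrized_initial: "skew_symmetrized (\<lambda>i. \<alpha> i \<bullet> \<alpha> i) n B0"
  unfolding skew_symmetrized_def
proof (intro conjI ballI)
  fix i j assume i: "i \<in> {1..n}" and j: "j \<in> {1..n}"
  show "(\<alpha> i \<bullet> \<alpha> i) * B0 i j = - ((\<alpha> j \<bullet> \<alpha> j) * B0 j i)"
    using i j cartan_eq[OF i j] cartan_eq[OF j i] inner_commute[of "\<alpha> i" "\<alpha> j"]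
    by (cases i j rule: linorder_cases) (auto simp: initial_matrix_def)
qed (use simple_root_nonzero in auto)

lemma laurent_expansion_x_exponents:
  assumes u: "u \<in> cluster_variables \<alpha> n" "rat_fun (laurent_expansion u) = u" and l: "l \<in> {1..n}"
  shows "\<exists>c. \<forall>e\<in>Poly_Mapping.keys (laurent_expansion u).
    Poly_Mapping.lookup e l = c + (\<Sum>j=1..n. B0 l j * Poly_Mapping.lookup e (n + j))"
proof -
  \<comment> \<open>One coordinate at a time: \<open>x l\<close> has degree 1, the other
    \<open>x i\<close> degree 0, and \<open>y j\<close> degree \<open>- B0 l j\<close>.\<close>
  define D where "D e = Poly_Mapping.lookup e l - (\<Sum>j=1..n. B0 l j * Poly_Mapping.lookup e (n + j))"
    for e :: "nat \<Rightarrow>\<^sub>0 int"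
  interpret exponent_grading D
    by unfold_locales (simp add: D_def lookup_add sum.distrib distrib_left)
  have D_x: "D (Poly_Mapping.single i 1) = (if i = l then 1 else 0)" if "i \<in> {1..n}" for i
    using that by (auto simp: D_def lookup_single when_def intro!: sum.neutral)
  have D_y: "D (Poly_Mapping.single (n + i) 1) = - B0 l i" if i: "i \<in> {1..n}" for i
  proof -
    have "(\<Sum>j=1..n. B0 l j * Poly_Mapping.lookup (Poly_Mapping.single (n + i) (1::int)) (n + j)) =
        (\<Sum>j=1..n. if j = i then B0 l j else 0)"
      by (intro sum.cong) (auto simp: lookup_single when_def)
    then show ?thesis using i l by (simp add: D_def lookup_single when_def)
  qed
  have "(\<Sum>i=1..2 * n. B0 i k * D (Poly_Mapping.single i 1)) = 0" if k: "k \<in> {1..n}" for k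
  proof -
    have "(\<Sum>i=1..n. B0 i k * D (Poly_Mapping.single i 1)) = (\<Sum>i=1..n. if i = l then B0 i k else 0)"
      by (intro sum.cong) (auto simp: D_x)
    moreover have "(\<Sum>i=1..n. B0 (n + i) k * D (Poly_Mapping.single (n + i) 1)) =
        (\<Sum>i=1..n. if i = k then - B0 l i else 0)"
      by (intro sum.cong) (use k in \<open>auto simp: D_y initial_matrix_def\<close>)
    ultimately show ?thesis
      using k l unfolding sum_frozen by simp
  qed
  then have "balanced n B0 (\<lambda>i. D (Poly_Mapping.single i 1))"
    unfolding balanced_def by blast
  then obtain c where "\<forall>e\<in>Poly_Mapping.keys (laurent_expansion u). D e = c"
    using cluster_variable_homogeneous[OF _ skew_symmetrized_initial, of "laurent_expansion u"] u by auto
  then show ?thesis unfolding D_def by (intro exI[of _ c]) force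
qed

text \<open>Exponent vectors are indexed by all naturals, so comparing two of them also involves the
  indices that carry no variable.\<close>

lemma laurent_expansion_other_exponents:
  assumes u: "u \<in> cluster_variables \<alpha> n" "rat_fun (laurent_expansion u) = u" and l: "l \<notin> {1..2 * n}"
  shows "\<exists>c. \<forall>e\<in>Poly_Mapping.keys (laurent_expansion u). Poly_Mapping.lookup e l = c"
proof -
  interpret exponent_grading "\<lambda>e. Poly_Mapping.lookup e l"
    by unfold_locales (simp add: lookup_add)
  have "balanced n B0 (\<lambda>i. Poly_Mapping.lookup (Poly_Mapping.single i 1) l)"
    using l unfolding balanced_def by (auto simp: lookup_single when_def intro!: sum.neutral)
  then show ?thesis
    using cluster_variable_homogeneous[OF _ skew_symmetrized_initial, of "laurent_expansion u"] u by auto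
qed

text \<open>Within one cluster variable, homogeneity makes the \<open>y\<close>-exponents determine
  the whole exponent vector.\<close>

lemma newton_F_cluster_variable:
  assumes u: "u \<in> cluster_variables \<alpha> n" "rat_fun (laurent_expansion u) = u"
  shows "newton_F \<alpha> n u = convex hull (y_exponent \<alpha> n ` Poly_Mapping.keys (laurent_expansion u))"
proof (rule newton_F_eq, rule inj_onI, rule poly_mapping_eqI)
  let ?f = "\<lambda>e. \<Sum>i = 1..n. Poly_Mapping.single (n + i) (Poly_Mapping.lookup e (n + i))"
  fix e e' l
  assume e: "e \<in> Poly_Mapping.keys (laurent_expansion u)" "e' \<in> Poly_Mapping.keys (laurent_expansion u)"
    and eq: "?f e = ?f e'"
  have lookup: "Poly_Mapping.lookup (?f e) (n + j) = Poly_Mapping.lookup e (n + j)"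
    if "j \<in> {1..n}" for e :: "nat \<Rightarrow>\<^sub>0 int" and j
    using that by (simp add: lookup_sum lookup_single when_def)
  have y: "Poly_Mapping.lookup e (n + j) = Poly_Mapping.lookup e' (n + j)" if "j \<in> {1..n}" for j
    using lookup[OF that] eq by metis
  consider "l \<in> {1..n}" | j where "j \<in> {1..n}" "l = n + j" | "l \<notin> {1..2 * n}"
  proof (cases "l \<in> {n + 1..2 * n}")
    case True
    then have "l - n \<in> {1..n}" "l = n + (l - n)" by auto
    then show thesis using that(2) by blast
  qed (use that in force)
  then show "Poly_Mapping.lookup e l = Poly_Mapping.lookup e' l"
  proof cases
    case 1
    obtain c where "\<forall>e\<in>Poly_Mapping.keys (laurent_expansion u).
        Poly_Mapping.lookup e l = c + (\<Sum>j=1..n. B0 l j * Poly_Mapping.lookup e (n + j))"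
      using laurent_expansion_x_exponents[OF u 1] by blast
    moreover have "(\<Sum>j=1..n. B0 l j * Poly_Mapping.lookup e (n + j)) =
        (\<Sum>j=1..n. B0 l j * Poly_Mapping.lookup e' (n + j))"
      by (intro sum.cong) (simp_all add: y)
    ultimately show ?thesis using e by simp
  next
    case 2
    then show ?thesis using y by blast
  next
    case 3
    then show ?thesis using laurent_expansion_other_exponents[OF u 3] e by metis
  qed
qed

text \<open>The map is multiplication by the exchange matrix in coordinates with respect to the
  simple roots.\<close>

lemma exists_exchange_map:
  "\<exists>M :: 'a \<Rightarrow> 'a. linear M \<and> (\<forall>j\<in>{1..n}. M (\<alpha> j) = (\<Sum>l=1..n. of_int (B0 l j) *\<^sub>R \<alpha> l))"
proof -
  obtain M :: "'a \<Rightarrow> 'a" where M: "linear M"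
    "\<And>b. b \<in> \<Delta> \<Longrightarrow> M b = (\<Sum>l=1..n. of_int (B0 l (the_inv_into {1..n} \<alpha> b)) *\<^sub>R \<alpha> l)"
    using linear_independent_extend[OF independent_Delta,
        of "\<lambda>b. \<Sum>l=1..n. of_int (B0 l (the_inv_into {1..n} \<alpha> b)) *\<^sub>R \<alpha> l"] by auto
  have "M (\<alpha> j) = (\<Sum>l=1..n. of_int (B0 l j) *\<^sub>R \<alpha> l)" if "j \<in> {1..n}" for j
    using M(2)[of "\<alpha> j"] that by (simp add: Delta_eq the_inv_into_f_f[OF inj_simple] del: One_nat_def)
  then show ?thesis using M(1) by blast
qed

text \<open>Homogeneity makes the \<open>x\<close>-exponent an affine function of the \<open>y\<close>-exponent whose linear part
  does not depend on the cluster variable.\<close>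
lemma newton_u_eq:
  assumes u: "u \<in> cluster_variables \<alpha> n" "rat_fun (laurent_expansion u) = u"
    and M: "linear M" "\<And>j. j \<in> {1..n} \<Longrightarrow> M (\<alpha> j) = (\<Sum>l=1..n. of_int (B0 l j) *\<^sub>R \<alpha> l)"
  shows "\<exists>c. newton_u \<alpha> n u = (+) (c, 0) ` (\<lambda>v. (M v, v)) ` newton_F \<alpha> n u"
proof -
  obtain c where c: "\<And>l e. l \<in> {1..n} \<Longrightarrow> e \<in> Poly_Mapping.keys (laurent_expansion u) \<Longrightarrow>
      Poly_Mapping.lookup e l = c l + (\<Sum>j=1..n. B0 l j * Poly_Mapping.lookup e (n + j))"
    using laurent_expansion_x_exponents[OF u] by metis
  define C where "C = (\<Sum>l=1..n. of_int (c l) *\<^sub>R \<alpha> l)"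
  have x: "x_exponent \<alpha> n e = C + M (y_exponent \<alpha> n e)"
    if e: "e \<in> Poly_Mapping.keys (laurent_expansion u)" for e
  proof -
    have "M (y_exponent \<alpha> n e) =
        (\<Sum>j=1..n. of_int (Poly_Mapping.lookup e (n + j)) *\<^sub>R (\<Sum>l=1..n. of_int (B0 l j) *\<^sub>R \<alpha> l))"
      unfolding y_exponent_def linear_sum[OF M(1)] linear_scale[OF M(1)]
      by (intro sum.cong) (simp_all add: M(2))
    also have "\<dots> = (\<Sum>l=1..n. \<Sum>j=1..n. of_int (B0 l j * Poly_Mapping.lookup e (n + j)) *\<^sub>R \<alpha> l)"
      unfolding scaleR_sum_right by (subst sum.swap) (simp add: mult.commute)
    also have "\<dots> = (\<Sum>l=1..n. of_int (\<Sum>j=1..n. B0 l j * Poly_Mapping.lookup e (n + j)) *\<^sub>R \<alpha> l)"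
      by (simp add: scaleR_sum_left)
    finally have "C + M (y_exponent \<alpha> n e) =
        (\<Sum>l=1..n. of_int (c l + (\<Sum>j=1..n. B0 l j * Poly_Mapping.lookup e (n + j))) *\<^sub>R \<alpha> l)"
      unfolding C_def by (simp add: scaleR_add_left sum.distrib)
    also have "\<dots> = x_exponent \<alpha> n e"
      unfolding x_exponent_def by (intro sum.cong) (simp_all only: c[OF _ e])
    finally show ?thesis by simp
  qed
  have lin: "linear (\<lambda>v. (M v, v))"
    using M(1) by (auto simp: linear_iff)
  have "(\<lambda>e. (x_exponent \<alpha> n e, y_exponent \<alpha> n e)) ` Poly_Mapping.keys (laurent_expansion u) =
      (+) (C, 0) ` (\<lambda>v. (M v, v)) ` y_exponent \<alpha> n ` Poly_Mapping.keys (laurent_expansion u)"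
    by (force simp: image_image x intro!: image_cong)
  then have "newton_u \<alpha> n u = (+) (C, 0) ` (\<lambda>v. (M v, v)) ` newton_F \<alpha> n u"
    unfolding newton_u_def newton_F_cluster_variable[OF u]
    by (simp add: convex_hull_translation convex_hull_linear_image[OF lin])
  then show ?thesis by blast
qed

end

section \<open>Minkowski sums under translations and linear maps\<close>

lemma sum_translations:
  fixes A :: "'b \<Rightarrow> 'a::comm_monoid_add set"
  assumes "finite K"
  shows "(\<Sum>k\<in>K. (+) (c k) ` A k) = (+) (\<Sum>k\<in>K. c k) ` (\<Sum>k\<in>K. A k)"
  using assms
proof (induction K)
  case (insert k K)
  have "(+) a ` A + (+) b ` B = (+) (a + b) ` (A + B)" for a b :: 'a and A B
    by (force simp: set_plus_def add_ac)
  then show ?case using insert by simp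
qed simp

lemma linear_image_set_sum:
  assumes "linear f"
  shows "f ` (\<Sum>k\<in>K. A k) = (\<Sum>k\<in>K. f ` A k)"
proof (induction K rule: infinite_finite_induct)
  case (insert k K)
  have "f ` (A + B) = f ` A + f ` B" for A B
    by (force simp: set_plus_def linear_add[OF assms])
  then show ?case using insert by simp
qed (simp_all add: linear_0[OF assms])

theorem theorem2p19:
  fixes \<Phi> \<Delta> :: "'a::euclidean_space set"
    and \<alpha> :: "nat \<Rightarrow> 'a"
    and n :: nat
    and u :: "'a \<Rightarrow> laurent fract"
  assumes "crystallographic_root_system \<Phi>"
    and "simple_system \<Phi> \<Delta>"
    and "bij_betw \<alpha> {1..n} \<Delta>"
    and "\<And>\<beta>. \<beta> \<in> positive_roots \<Phi> \<Delta> \<Longrightarrow>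
           u \<beta> \<in> non_initial_cluster_variables \<alpha> n \<and> has_d_vector \<alpha> n (u \<beta>) \<beta>"
    and "\<And>\<beta>. \<beta> \<in> positive_roots \<Phi> \<Delta> \<Longrightarrow>
           newton_F \<alpha> n (u \<beta>) =
             convex hull {weight_function \<alpha> n I (root_position \<alpha> n \<beta>)
                          - weight_function \<alpha> n (antigreedy_facet \<alpha> n) (root_position \<alpha> n \<beta>)
                          | I. I \<in> facets \<alpha> n}"
  shows "(\<exists>t. brick_polytope \<alpha> n = (+) t ` (\<Sum>\<beta>\<in>positive_roots \<Phi> \<Delta>. newton_F \<alpha> n (u \<beta>))) \<and>
         (\<exists>\<phi> :: 'a \<Rightarrow> 'a \<times> 'a.
            affine_embedding \<phi> \<and>
            (\<Sum>\<beta>\<in>positive_roots \<Phi> \<Delta>. newton_u \<alpha> n (u \<beta>)) \<subseteq> range \<phi> \<and>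
            (\<exists>t. (\<Sum>\<beta>\<in>positive_roots \<Phi> \<Delta>. newton_u \<alpha> n (u \<beta>)) = (+) t ` \<phi> ` brick_polytope \<alpha> n))"
proof -
  interpret root_basis \<Phi> \<Delta> \<alpha> n
    using assms(1-3) by unfold_locales
  let ?SF = "\<Sum>b\<in>\<Phi>p. newton_F \<alpha> n (u b)" and ?Su = "\<Sum>b\<in>\<Phi>p. newton_u \<alpha> n (u b)"
  let ?a = "\<lambda>k. - wt (antigreedy_facet \<alpha> n) k"
  define G where "G k = (+) (?a k) ` (convex hull ((\<lambda>I. wt I k) ` F))" for k
  have newton_F: "newton_F \<alpha> n (u b) = G (root_position \<alpha> n b)" if "b \<in> \<Phi>p" for b
    unfolding G_def assms(5)[OF that] convex_hull_translation[symmetric]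
    by (intro arg_cong[of _ _ "(hull) convex"]) auto
  have "?SF = (\<Sum>k=n + 1..n + N. G k)"
    unfolding sum_root_position[symmetric] by (intro sum.cong refl newton_F)
  then have SF: "?SF = (+) (\<Sum>k=n + 1..n + N. ?a k) ` (\<Sum>k=n + 1..n + N. convex hull ((\<lambda>I. wt I k) ` F))"
    unfolding G_def by (simp only: sum_translations[OF finite_atLeastAtMost])
  obtain t where t: "brick_polytope \<alpha> n = (+) t ` ?SF"
  proof
    \<comment> \<open>The translation vector is the brick vector of the antigreedy facet.\<close>
    show "brick_polytope \<alpha> n =
        (+) ((\<Sum>k=1..n. \<omega> k) - (\<Sum>k=n + 1..n + N. ?a k)) ` ?SF"
      unfolding SF brick_polytope_eq by (simp add: image_image algebra_simps)
  qed
  obtain M :: "'a \<Rightarrow> 'a" where M: "linear M"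
    "\<And>j. j \<in> {1..n} \<Longrightarrow> M (\<alpha> j) = (\<Sum>l=1..n. of_int (B0 l j) *\<^sub>R \<alpha> l)"
    using exists_exchange_map by blast
  have lin: "linear (\<lambda>v. (M v, v))"
    using M(1) by (auto simp: linear_iff)
  have "\<forall>b\<in>\<Phi>p. \<exists>c. newton_u \<alpha> n (u b) = (+) (c, 0) ` (\<lambda>v. (M v, v)) ` newton_F \<alpha> n (u b)"
  proof
    fix b assume "b \<in> \<Phi>p"
    then have "u b \<in> cluster_variables \<alpha> n" "has_d_vector \<alpha> n (u b) b"
      using assms(4) by (auto simp: non_initial_cluster_variables_def)
    then show "\<exists>c. newton_u \<alpha> n (u b) = (+) (c, 0) ` (\<lambda>v. (M v, v)) ` newton_F \<alpha> n (u b)"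
      using M rat_fun_laurent_expansion by (intro newton_u_eq)
  qed
  then obtain c where c: "\<And>b. b \<in> \<Phi>p \<Longrightarrow>
      newton_u \<alpha> n (u b) = (+) (c b, 0) ` (\<lambda>v. (M v, v)) ` newton_F \<alpha> n (u b)"
    by metis
  define C where "C = (\<Sum>b\<in>\<Phi>p. (c b, 0 :: 'a))"
  have Su: "?Su = (+) C ` (\<lambda>v. (M v, v)) ` ?SF"
    by (simp add: c C_def sum_translations[OF finite_positive_roots] linear_image_set_sum[OF lin])
  \<comment> \<open>The graph map is injective through its second component; the shift
    \<open>C\<close> collects the translations of all summands and puts the sum into the
    range.\<close>
  define \<phi> where "\<phi> v = (M v, v) + C" for v
  have "inj \<phi>"
    by (simp add: inj_def \<phi>_def)
  then have "affine_embedding \<phi>"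
    unfolding affine_embedding_def using lin \<phi>_def by blast
  moreover have "?Su \<subseteq> range \<phi>"
    unfolding Su \<phi>_def by (auto simp: add.commute)
  \<comment> \<open>By linearity of the graph map, the translation by \<open>t\<close> in the first
    part turns into the translation by \<open>(M t, t)\<close>.\<close>
  moreover have "?Su = (+) (- (M t, t)) ` \<phi> ` brick_polytope \<alpha> n"
    unfolding Su t image_image \<phi>_def
    by (intro image_cong) (simp_all add: linear_add[OF M(1)] prod_eq_iff)
  ultimately show ?thesis using t by blast
qed

end
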